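(* Let $G$ be a unicyclic graph with $n\geq 6$ vertices and let $h:\mathbb{Z}^+\to\mathbb{R}$. (1) If $h$ is strictly increasing, then \[ n\,h(1)+\frac12 n(n-3)\,h(2)\leq W_h(G)\leq F_h(3,n)=n\,h(1)+\sum_{j=2}^{n-2}(n-j)\,h(j), \] with equality in the lower bound if and only if $G\cong J_n$, and equality in the upper bound if and only if $G\cong G_{3,n}$. (2) If $h$ is strictly decreasing, then \[ F_h(3,n)\leq W_h(G)\leq n\,h(1)+\frac12 n(n-3)\,h(2), \] with equality in the lower bound if and only if $G\cong G_{3,n}$, and equality in the upper bound if and only if $G\cong J_n$.
   Context: Graphs are finite, connected, simple. A unicyclic graph is a connected graph containing exactly one cycle. For a function $h:\mathbb{Z}^+\to\mathbb{R}$, the $h$-Wiener index is $W_h(G)=\sum_{\{u,v\}\subseteq V(G)} h(d(u,v))$, summed over unordered pairs of distinct vertices, $d$ the shortest-path distance. $J_n$ ($n\ge4$) is the graph obtained by identifying a vertex of a triangle $C_3$ with the center (vertex of degree $n-3$) of a star with $n-2$ vertices. $G_{3,n}$ is the graph obtained by identifying a vertex of a triangle $C_3$ with an endpoint of a path with $n-2$ vertices. *)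

theory Defs
  imports "Graph_Theory.Graph_Theory"
begin

text \<open>
  Finite simple graphs are represented by \<^locale>\<open>pair_graph\<close>: a finite vertex set with a
  symmetric and irreflexive set of arcs, so that an edge is a pair of opposite arcs.
\<close>

definition graph_dist :: "'a pair_pre_digraph \<Rightarrow> 'a \<Rightarrow> 'a \<Rightarrow> nat" where
  "graph_dist G u v = (LEAST k. \<exists>p. pre_digraph.apath (with_proj G) u p v \<and> length p = k)"

text \<open>
  The sum ranges over two-element sets of vertices. As \<^const>\<open>graph_dist\<close> is symmetric on
  graphs, the definite description is well defined; see \<open>pair_dist_eq\<close> below.
\<close>

definition wiener_index :: "(nat \<Rightarrow> real) \<Rightarrow> 'a pair_pre_digraph \<Rightarrow> real" where
  "wiener_index h G =
     (\<Sum>e | e \<subseteq> pverts G \<and> card e = 2.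
        h (THE d. \<exists>u v. e = {u, v} \<and> d = graph_dist G u v))"

text \<open>
  A closed walk without repeated vertices describes a cycle of a simple graph if its length is
  at least 3 (running along an edge and back is a \<^const>\<open>pre_digraph.cycle\<close> of length 2).
  Walks that differ only in starting point or orientation describe the same cycle, so
  cycles are counted by their sets of undirected edges.
\<close>

definition cycle_edge_sets :: "'a pair_pre_digraph \<Rightarrow> 'a set set set" where
  "cycle_edge_sets G =
     {(\<lambda>a. {fst a, snd a}) ` set p | p. pre_digraph.cycle (with_proj G) p \<and> 3 \<le> length p}"

definition unicyclic :: "'a pair_pre_digraph \<Rightarrow> bool" where
  "unicyclic G \<longleftrightarrow> Digraph_Component.connected (with_proj G) \<and> (\<exists>!C. C \<in> cycle_edge_sets G)"

definition undirected :: "'a set \<Rightarrow> ('a \<times> 'a) set \<Rightarrow> 'a pair_pre_digraph" where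
  "undirected V A = \<lparr> pverts = V, parcs = A \<union> A\<inverse> \<rparr>"

definition graph_union ::
    "'a pair_pre_digraph \<Rightarrow> 'a pair_pre_digraph \<Rightarrow> 'a pair_pre_digraph" where
  "graph_union G H = \<lparr> pverts = pverts G \<union> pverts H, parcs = parcs G \<union> parcs H \<rparr>"

definition triangle :: "nat pair_pre_digraph" where
  "triangle = undirected {0, 1, 2} {(0, 1), (0, 2), (1, 2)}"

text \<open>
  The star (with center 2) and the path (with endpoint 2), each on the \<open>n - 2\<close> vertices
  \<open>2, \<dots>, n - 1\<close>. They meet the triangle in the vertex 2 only, so that the unions below
  identify this vertex of the triangle with the center and the endpoint, respectively.
\<close>

definition star_from_2 :: "nat \<Rightarrow> nat pair_pre_digraph" where
  "star_from_2 n = undirected {2..<n} {(2, i) | i. 2 < i \<and> i < n}"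

definition path_from_2 :: "nat \<Rightarrow> nat pair_pre_digraph" where
  "path_from_2 n = undirected {2..<n} {(i, Suc i) | i. 2 \<le> i \<and> Suc i < n}"

definition J_graph :: "nat \<Rightarrow> nat pair_pre_digraph" where
  "J_graph n = graph_union triangle (star_from_2 n)"

definition G3_graph :: "nat \<Rightarrow> nat pair_pre_digraph" where
  "G3_graph n = graph_union triangle (path_from_2 n)"

definition graph_iso :: "'a pair_pre_digraph \<Rightarrow> 'b pair_pre_digraph \<Rightarrow> bool"
    (infix \<open>\<cong>\<^sub>g\<close> 50) where
  "G \<cong>\<^sub>g H \<longleftrightarrow> digraph_iso (with_proj G) (with_proj H)"

lemma apath_rev:
  assumes "pair_graph G" "pre_digraph.apath (with_proj G) u p v"
  shows "\<exists>q. pre_digraph.apath (with_proj G) v q u \<and> length q = length p"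
proof -
  interpret pair_graph G by fact
  have sym: "(b, a) \<in> parcs G" if "(a, b) \<in> parcs G" for a b
    using that pair_sym_arcs by (auto simp: symmetric_def dest: symD)
  have awalk_rev: "\<exists>q. awalk v q u \<and> length q = length p \<and> awalk_verts v q = rev (awalk_verts u p)"
    if "awalk u p v" for u p v
    using that
  proof (induction p arbitrary: u)
    case Nil
    then show ?case by (intro exI[of _ "[]"]) (auto simp: awalk_def)
  next
    case (Cons a p)
    then have a: "a \<in> parcs G" "fst a = u" and "awalk (snd a) p v"
      by (auto simp: awalk_Cons_iff)
    then obtain q where q: "awalk v q (snd a)" "length q = length p"
      "awalk_verts v q = rev (awalk_verts (snd a) p)"
      using Cons.IH by blast
    have "awalk (snd a) [(snd a, u)] u"
      using a sym by (cases a) (auto simp: awalk_def in_arcsD1 in_arcsD2)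
    with q(1) have "awalk v (q @ [(snd a, u)]) u" by (rule awalk_appendI)
    moreover have "awalk_verts v (q @ [(snd a, u)]) = rev (awalk_verts u (a # p))"
      using q a awalk_verts_append[OF calculation] by auto
    ultimately show ?case using q by (intro exI[of _ "q @ [(snd a, u)]"]) auto
  qed
  then show ?thesis using assms(2) unfolding apath_def by fastforce
qed

lemma graph_dist_commute:
  assumes "pair_graph G"
  shows "graph_dist G u v = graph_dist G v u"
  unfolding graph_dist_def
  by (rule arg_cong[where f = Least], rule ext) (metis apath_rev[OF assms])

lemma pair_dist_eq:
  assumes "pair_graph G"
  shows "(THE d. \<exists>x y. {u, v} = {x, y} \<and> d = graph_dist G x y) = graph_dist G u v"
  by (rule the_equality) (auto simp: doubleton_eq_iff graph_dist_commute[OF assms])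

end

theory Submission
  imports Defs
begin

text \<open>
  It suffices to treat increasing \<open>h\<close>; the decreasing case follows by passing to \<open>-h\<close>.
  A unicyclic graph is connected with \<open>n\<close> edges: it has exactly one edge outside a breadth-first
  search tree, as each such edge closes a cycle of its own.

  Lower bound: \<open>n\<close> pairs have distance 1, all others distance at least 2. In the case of equality
  the diameter is at most 2; as \<open>n \<ge> 6\<close>, not all degrees are 2, so there is a leaf, and the
  neighbour of the leaf is adjacent to every vertex.

  Upper bound, by induction for all connected graphs with at least \<open>n\<close> edges: removing a non-cut
  vertex \<open>x\<close> does not decrease the other distances, and the distances from \<open>x\<close> fill an interval
  \<open>{1..e}\<close>. If at least \<open>n - 1\<close> edges remain for some \<open>x\<close>, a level from \<open>x\<close> has two
  vertices, so that \<open>x\<close> contributes at most \<open>h 1 + \<dots> + h (n - 2) + h (n - 2)\<close>, with equality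
  only for level sizes \<open>1, \<dots>, 1, 2\<close>; with \<open>n\<close> edges this is the triangle with a pendant path.
  If there is no such \<open>x\<close>, every non-cut vertex has two neighbours and contributes at most
  \<open>h 1 + h 1 + h 2 + \<dots> + h (n - 2)\<close>, and the rest is bounded by the value of a path. Equality
  would then force a leaf, whose removal keeps \<open>n - 1\<close> edges.
\<close>

section \<open>Sums over the levels of a rooted graph\<close>

text \<open>Either level \<open>e\<close> is still occupied and the image is unchanged, or it
  shrinks to \<open>{1..e - 1}\<close>. Having no gaps thus survives the removal of a top element,
  which drives the inductions on \<open>S\<close> below.\<close>

lemma image_remove_top:
  fixes f :: "'a \<Rightarrow> nat"
  assumes "f ` S = {1..e}" "x \<in> S" "f x = e"
  shows "\<exists>e'. f ` (S - {x}) = {1..e'}"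
proof -
  have ins: "insert e (f ` (S - {x})) = {1..e}"
    using assms by (metis image_insert insert_Diff)
  show ?thesis
  proof (cases "e \<in> f ` (S - {x})")
    case True
    then show ?thesis using ins by (auto simp: insert_absorb)
  next
    case False
    then have "f ` (S - {x}) = {1..e} - {e}" using ins by (metis Diff_insert_absorb)
    also have "\<dots> = {1..e - 1}" by auto
    finally show ?thesis ..
  qed
qed

lemma top_le_card:
  fixes f :: "'a \<Rightarrow> nat"
  assumes "finite S" "f ` S = {1..e}"
  shows "e \<le> card S"
  using card_image_le[OF assms(1), of f] assms(2) by simp

text \<open>Levels without gaps cannot rise above \<open>card S\<close>. Peeling off a top element
  costs at most \<open>h (card S)\<close> and leaves levels without gaps on the rest.\<close>

lemma level_sum_le:
  fixes f :: "'a \<Rightarrow> nat" and h :: "nat \<Rightarrow> real"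
  assumes h: "strict_mono_on {1..} h" and "finite S" "f ` S = {1..e}"
  shows "(\<Sum>x\<in>S. h (f x)) \<le> (\<Sum>j=1..card S. h j)"
  using assms(2,3)
proof (induction "card S" arbitrary: S e)
  case 0
  then show ?case by simp
next
  case (Suc m)
  from Suc.hyps(2) have "S \<noteq> {}" by auto
  with Suc.prems have "e \<in> f ` S" by (cases e) auto
  then obtain x where x: "x \<in> S" "f x = e" by auto
  obtain e' where "f ` (S - {x}) = {1..e'}" using image_remove_top[OF Suc.prems(2) x] by blast
  moreover have c: "card (S - {x}) = m" using Suc x by simp
  ultimately have "(\<Sum>x\<in>S - {x}. h (f x)) \<le> (\<Sum>j=1..m. h j)"
    using Suc.hyps(1)[of "S - {x}" e'] Suc.prems by simp
  moreover have "h e \<le> h (Suc m)"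
    using top_le_card[OF Suc.prems] Suc.hyps(2) x Suc.prems(2)
    by (intro strict_mono_on_leD[OF h]) auto
  ultimately show ?case using Suc.prems x Suc.hyps(2)[symmetric]
    by (simp add: sum.remove[of S x])
qed

lemma inj_levels_eq:
  fixes f :: "'a \<Rightarrow> nat"
  assumes "finite S" "f ` S = {1..e}" "inj_on f S"
  shows "e = card S"
  using card_image[OF assms(3)] assms(2) by simp

text \<open>A repeated level keeps the top below \<open>card S\<close>, so a removed top element
  costs at most \<open>h (card S - 1)\<close>. If the rest is injective, it fills
  \<open>{1..card S - 1}\<close>, and equality puts the removed element on the last of these levels;
  otherwise the inequality is strict.\<close>

lemma level_sum_le_not_inj:
  fixes f :: "'a \<Rightarrow> nat" and h :: "nat \<Rightarrow> real"
  assumes h: "strict_mono_on {1..} h" and "finite S" "f ` S = {1..e}" "\<not> inj_on f S"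
  shows "(\<Sum>x\<in>S. h (f x)) \<le> (\<Sum>j=1..card S - 1. h j) + h (card S - 1) \<and>
    ((\<Sum>x\<in>S. h (f x)) = (\<Sum>j=1..card S - 1. h j) + h (card S - 1) \<longrightarrow>
      (\<exists>x\<in>S. f x = card S - 1 \<and> bij_betw f (S - {x}) {1..card S - 1}))"
  using assms(2-4)
proof (induction "card S" arbitrary: S e)
  case 0
  then show ?case by simp
next
  case (Suc m)
  from Suc.hyps(2) have "S \<noteq> {}" by auto
  with Suc.prems have "e \<in> f ` S" by (cases e) auto
  then obtain x where x: "x \<in> S" "f x = e" by auto
  obtain e' where e': "f ` (S - {x}) = {1..e'}" using image_remove_top[OF Suc.prems(2) x] by blast
  have c: "card (S - {x}) = m" using Suc x by simp
  have split: "(\<Sum>x\<in>S. h (f x)) = h e + (\<Sum>x\<in>S - {x}. h (f x))"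
    using Suc.prems x by (simp add: sum.remove[of S x])
  \<comment> \<open>\<open>e = card S\<close> would give the image \<open>card S\<close> elements
    and so make \<open>f\<close> injective.\<close>
  have "e < Suc m"
    using top_le_card[OF Suc.prems(1,2)] eq_card_imp_inj_on[OF Suc.prems(1), of f] Suc.prems Suc.hyps(2)
    by (metis card_atLeastAtMost diff_Suc_1 le_neq_implies_less)
  have e1: "e \<ge> 1" using x Suc.prems(2) by auto
  show ?case
  proof (cases "inj_on f (S - {x})")
    case True
    then have e'm: "e' = m" using inj_levels_eq[OF _ e'] Suc.prems c by simp
    have "(\<Sum>x\<in>S - {x}. h (f x)) = (\<Sum>j\<in>f ` (S - {x}). h j)"
      by (simp add: sum.reindex[OF True])
    then have s: "(\<Sum>x\<in>S - {x}. h (f x)) = (\<Sum>j=1..m. h j)" using e' e'm by simp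
    have "h e \<le> h m" using \<open>e < Suc m\<close> e1 by (intro strict_mono_on_leD[OF h]) auto
    moreover have "e = m" if "h e = h m"
      using that \<open>e < Suc m\<close> e1 strict_mono_onD[OF h, of e m] by fastforce
    moreover have "bij_betw f (S - {x}) {1..m}" using True e' e'm by (simp add: bij_betw_def)
    ultimately show ?thesis using split s Suc.hyps(2)[symmetric] x
      by auto
  next
    case False
    then have "(\<Sum>x\<in>S - {x}. h (f x)) \<le> (\<Sum>j=1..m - 1. h j) + h (m - 1)"
      using Suc.hyps(1)[of "S - {x}" e'] Suc.prems c e' by auto
    moreover have "m \<ge> 2"
    proof (rule ccontr)
      assume "\<not> 2 \<le> m"
      then have "card (S - {x}) \<le> Suc 0" using c by simp
      then have "inj_on f (S - {x})" using Suc.prems(1)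
        by (metis card_le_Suc0_iff_eq finite_Diff inj_onI)
      with False show False ..
    qed
    moreover then have "(\<Sum>j=1..m. h j) = (\<Sum>j=1..m - 1. h j) + h m"
      by (cases m) auto
    moreover have "h e \<le> h m" using \<open>e < Suc m\<close> e1 by (intro strict_mono_on_leD[OF h]) auto
    moreover have "h (m - 1) < h m" using \<open>m \<ge> 2\<close> by (intro strict_mono_onD[OF h]) auto
    \<comment> \<open>Strictness makes the claim about equality vacuous in this case.\<close>
    ultimately have "(\<Sum>x\<in>S. h (f x)) < (\<Sum>j=1..m. h j) + h m"
      unfolding split by linarith
    then show ?thesis unfolding Suc.hyps(2)[symmetric] by simp
  qed
qed

text \<open>A collision would replace the last summand \<open>h (card S)\<close> by at most
  \<open>h (card S - 1)\<close>.\<close>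

lemma level_sum_eq_imp_inj:
  fixes f :: "'a \<Rightarrow> nat" and h :: "nat \<Rightarrow> real"
  assumes h: "strict_mono_on {1..} h" and S: "finite S" "f ` S = {1..e}"
    and eq: "(\<Sum>x\<in>S. h (f x)) = (\<Sum>j=1..card S. h j)"
  shows "inj_on f S"
proof (rule ccontr)
  assume ni: "\<not> inj_on f S"
  then have "\<not> card S \<le> Suc 0" using S(1) by (metis card_le_Suc0_iff_eq inj_onI)
  then have "h (card S - 1) < h (card S)" by (intro strict_mono_onD[OF h]) auto
  moreover have "(\<Sum>j=1..card S. h j) = (\<Sum>j=1..card S - 1. h j) + h (card S)"
    using \<open>\<not> card S \<le> Suc 0\<close> by (cases "card S") auto
  ultimately show False using level_sum_le_not_inj[OF h S ni] eq by linarith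
qed

text \<open>Without \<open>a\<close>, level 1 is still occupied by \<open>b\<close>, so the levels
  of the rest have no gaps and the general bound applies to one vertex fewer.\<close>

lemma level_sum_le_two_first:
  fixes f :: "'a \<Rightarrow> nat" and h :: "nat \<Rightarrow> real"
  assumes h: "strict_mono_on {1..} h" and S: "finite S" "f ` S = {1..e}"
    and ab: "a \<in> S" "b \<in> S" "a \<noteq> b" "f a = 1" "f b = 1"
  shows "(\<Sum>x\<in>S. h (f x)) \<le> h 1 + (\<Sum>j=1..card S - 1. h j)"
    and "(\<Sum>x\<in>S. h (f x)) = h 1 + (\<Sum>j=1..card S - 1. h j) \<Longrightarrow> inj_on f (S - {a})"
proof -
  have "insert 1 (f ` (S - {a})) = {1..e}"
    using S ab by (metis image_insert insert_Diff)
  moreover have "1 \<in> f ` (S - {a})" using ab by force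
  ultimately have i: "f ` (S - {a}) = {1..e}" by (simp add: insert_absorb)
  have split: "(\<Sum>x\<in>S. h (f x)) = h 1 + (\<Sum>x\<in>S - {a}. h (f x))"
    using S ab by (simp add: sum.remove[of S a])
  have c: "card (S - {a}) = card S - 1" using S ab by simp
  have f: "finite (S - {a})" using S by simp
  from level_sum_le[OF h f i] split c
  show "(\<Sum>x\<in>S. h (f x)) \<le> h 1 + (\<Sum>j=1..card S - 1. h j)" by simp
  from level_sum_eq_imp_inj[OF h f i] split c
  show "(\<Sum>x\<in>S. h (f x)) = h 1 + (\<Sum>j=1..card S - 1. h j) \<Longrightarrow> inj_on f (S - {a})" by simp
qed

section \<open>Connected graphs and their distances\<close>

text \<open>Relation powers describe walks without naming their arcs, which suits vertex deletion
  and relabelling. For connected graphs, \<open>graph_dist_eq_rel_dist\<close> identifies this with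
  the distance by paths.\<close>

definition rel_dist :: "'a rel \<Rightarrow> 'a \<Rightarrow> 'a \<Rightarrow> nat" where
  "rel_dist R u v = (LEAST k. (u, v) \<in> R ^^ k)"

definition del_vertex :: "'a \<Rightarrow> 'a rel \<Rightarrow> 'a rel" where
  "del_vertex x R = {(a, b) \<in> R. a \<noteq> x \<and> b \<noteq> x}"

definition pairs :: "'a set \<Rightarrow> 'a set set" where
  "pairs V = {e. e \<subseteq> V \<and> card e = 2}"

text \<open>The same definite description as in \<open>wiener_index\<close>, so that the two sums
  agree term by term once the distances agree.\<close>

definition wiener_sum :: "(nat \<Rightarrow> real) \<Rightarrow> 'a set \<Rightarrow> 'a rel \<Rightarrow> real" where
  "wiener_sum h V R = (\<Sum>e\<in>pairs V. h (THE d. \<exists>u v. e = {u, v} \<and> d = rel_dist R u v))"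

lemma finite_pairs [simp]: "finite V \<Longrightarrow> finite (pairs V)"
  by (simp add: pairs_def)

lemma rel_dist_le: "(u, v) \<in> R ^^ k \<Longrightarrow> rel_dist R u v \<le> k"
  by (simp add: rel_dist_def Least_le)

lemma rel_dist_self [simp]: "rel_dist R u u = 0"
  using rel_dist_le[of u u 0 R] by simp

lemma relpow_subset_mono: "R \<subseteq> S \<Longrightarrow> R ^^ k \<subseteq> S ^^ k" for R S :: "'a rel"
  by (induction k) (auto simp: relcomp_mono)

lemma del_vertex_subset: "del_vertex x R \<subseteq> R"
  by (auto simp: del_vertex_def)

lemma sum_pairs_remove:
  fixes \<phi> :: "'a set \<Rightarrow> 'b :: comm_monoid_add"
  assumes "finite V" "x \<in> V"
  shows "sum \<phi> (pairs V) = sum \<phi> (pairs (V - {x})) + (\<Sum>u\<in>V - {x}. \<phi> {x, u})"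
proof -
  have "pairs V = pairs (V - {x}) \<union> (\<lambda>u. {x, u}) ` (V - {x})" (is "_ = _ \<union> ?B")
  proof (intro equalityI subsetI)
    fix e assume "e \<in> pairs V"
    then obtain a b where "e = {a, b}" "a \<noteq> b" "a \<in> V" "b \<in> V"
      by (auto simp: pairs_def card_2_iff)
    then show "e \<in> pairs (V - {x}) \<union> ?B"
      by (cases "a = x"; cases "b = x") (auto simp: pairs_def)
  qed (use assms in \<open>auto simp: pairs_def\<close>)
  moreover have "pairs (V - {x}) \<inter> ?B = {}" by (auto simp: pairs_def)
  moreover have "inj_on (\<lambda>u. {x, u}) (V - {x})" by (auto simp: inj_on_def doubleton_eq_iff)
  ultimately show ?thesis using assms
    by (simp add: sum.union_disjoint sum.reindex)
qed

text \<open>With ordered pairs, the arcs of a graph can be split off as a subset of the index set;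
  each unordered pair is then counted twice.\<close>

lemma sum_pairs_double:
  fixes \<phi> :: "'a set \<Rightarrow> real"
  assumes "finite V"
  shows "2 * sum \<phi> (pairs V) = (\<Sum>(a, b)\<in>Sigma V (\<lambda>a. V - {a}). \<phi> {a, b})"
proof -
  have "2 * sum \<phi> (pairs V) = (\<Sum>a\<in>V. \<Sum>b\<in>V - {a}. \<phi> {a, b})"
    using assms
  proof induction
    case empty
    have "pairs {} = ({} :: 'a set set)" by (auto simp: pairs_def)
    then show ?case by simp
  next
    case (insert x V)
    have "(\<Sum>b\<in>insert x V - {a}. \<phi> {a, b}) = \<phi> {x, a} + (\<Sum>b\<in>V - {a}. \<phi> {a, b})" if "a \<in> V" for a
    proof -
      have "insert x V - {a} = insert x (V - {a})" using that insert by auto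
      then show ?thesis using insert by (simp add: insert_commute)
    qed
    then have "(\<Sum>a\<in>insert x V. \<Sum>b\<in>insert x V - {a}. \<phi> {a, b})
       = 2 * (\<Sum>b\<in>V. \<phi> {x, b}) + (\<Sum>a\<in>V. \<Sum>b\<in>V - {a}. \<phi> {a, b})"
      using insert by (simp add: sum.distrib)
    then show ?case using insert sum_pairs_remove[of "insert x V" x \<phi>] by simp
  qed
  then show ?thesis using assms by (simp add: sum.Sigma)
qed

text \<open>The relation contains both orientations of every edge, so \<open>m\<close> edges are \<open>2 * m\<close> arcs.\<close>

locale connected_graph =
  fixes V :: "'a set" and R :: "'a rel"
  assumes finite_verts: "finite V"
    and arcs_subset: "R \<subseteq> V \<times> V"
    and sym_arcs: "sym R"
    and no_loop: "(x, x) \<notin> R"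
    and reachable: "u \<in> V \<Longrightarrow> v \<in> V \<Longrightarrow> (u, v) \<in> R\<^sup>*"
begin

lemma finite_arcs: "finite R"
  using finite_subset[OF arcs_subset] finite_verts by auto

lemma arcD: "(u, v) \<in> R \<Longrightarrow> u \<in> V \<and> v \<in> V \<and> u \<noteq> v \<and> (v, u) \<in> R"
  using arcs_subset sym_arcs no_loop by (auto dest: symD)

lemma relpow_sym: "(u, v) \<in> R ^^ k \<Longrightarrow> (v, u) \<in> R ^^ k"
proof (induction k arbitrary: v)
  case (Suc k)
  then obtain w where "(u, w) \<in> R ^^ k" "(w, v) \<in> R" by auto
  then show ?case using Suc.IH arcD relpow_Suc_I2 by metis
qed auto

lemma rel_dist_relpow:
  assumes "u \<in> V" "v \<in> V"
  shows "(u, v) \<in> R ^^ rel_dist R u v"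
  unfolding rel_dist_def using rtrancl_imp_relpow[OF reachable[OF assms]] LeastI_ex by metis

lemma rel_dist_sym: "rel_dist R u v = rel_dist R v u"
  unfolding rel_dist_def by (rule arg_cong[where f = Least], rule ext) (metis relpow_sym)

lemma rel_dist_eq_0_iff: "u \<in> V \<Longrightarrow> v \<in> V \<Longrightarrow> rel_dist R u v = 0 \<longleftrightarrow> u = v"
  using rel_dist_relpow[of u v] by auto

lemma rel_dist_arc_le: "u \<in> V \<Longrightarrow> (v, w) \<in> R \<Longrightarrow> rel_dist R u w \<le> Suc (rel_dist R u v)"
  using rel_dist_relpow[of u v] arcD[of v w] by (auto intro!: rel_dist_le)

lemma rel_dist_pred:
  assumes "u \<in> V" "v \<in> V" "rel_dist R u v = Suc k"
  obtains w where "w \<in> V" "(w, v) \<in> R" "rel_dist R u w = k"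
proof -
  from rel_dist_relpow[OF assms(1,2)] assms(3) obtain w where w: "(u, w) \<in> R ^^ k" "(w, v) \<in> R" by auto
  moreover have "rel_dist R u w = k"
    using rel_dist_le[OF w(1)] rel_dist_arc_le[OF assms(1) w(2)] assms(3) by simp
  ultimately show thesis using that arcD by blast
qed

lemma rel_dist_eq_1_iff: "u \<in> V \<Longrightarrow> v \<in> V \<Longrightarrow> rel_dist R u v = 1 \<longleftrightarrow> (u, v) \<in> R"
proof
  assume "u \<in> V" "v \<in> V" "rel_dist R u v = 1"
  then show "(u, v) \<in> R" using rel_dist_relpow[of u v] by simp
next
  assume "u \<in> V" "v \<in> V" "(u, v) \<in> R"
  then show "rel_dist R u v = 1" using rel_dist_le[of u v 1 R] rel_dist_eq_0_iff[of u v] no_loop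
    by (cases "rel_dist R u v") auto
qed

lemma rel_dist_pos: "u \<in> V \<Longrightarrow> v \<in> V \<Longrightarrow> u \<noteq> v \<Longrightarrow> 1 \<le> rel_dist R u v"
  using rel_dist_eq_0_iff[of u v] by simp

text \<open>A shortest walk passes through every smaller distance from \<open>r\<close>, so no
  distance is skipped.\<close>

lemma levels:
  assumes "r \<in> V"
  shows "\<exists>e. rel_dist R r ` (V - {r}) = {1..e}"
proof -
  have down: "\<exists>w\<in>V. rel_dist R r w = k" if "v \<in> V" "k \<le> rel_dist R r v" for k v
    using that
  proof (induction "rel_dist R r v" arbitrary: v)
    case (Suc d)
    show ?case
    proof (cases "k = Suc d")
      case False
      obtain w where "w \<in> V" "rel_dist R r w = d" using rel_dist_pred[OF assms Suc.prems(1) Suc.hyps(2)[symmetric]] .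
      then show ?thesis using Suc.hyps Suc.prems False by (metis le_Suc_eq)
    qed (use Suc in auto)
  qed auto
  define e where "e = Max (rel_dist R r ` V)"
  have fe: "finite (rel_dist R r ` V)" "rel_dist R r ` V \<noteq> {}" using finite_verts assms by auto
  then obtain x where x: "x \<in> V" "rel_dist R r x = e" using Max_in[OF fe] unfolding e_def by (metis imageE)
  have "rel_dist R r ` (V - {r}) = {1..e}"
  proof (intro equalityI subsetI)
    fix k assume "k \<in> rel_dist R r ` (V - {r})"
    then show "k \<in> {1..e}" using fe rel_dist_pos assms unfolding e_def by auto
  next
    fix k assume "k \<in> {1..e}"
    then obtain w where "w \<in> V" "rel_dist R r w = k" "k \<ge> 1" using down[OF x(1), of k] x(2) by auto
    then show "k \<in> rel_dist R r ` (V - {r})" by force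
  qed
  then show ?thesis ..
qed

lemma farthest_exists:
  assumes "r \<in> V"
  obtains x where "x \<in> V" "\<And>y. y \<in> V \<Longrightarrow> rel_dist R r y \<le> rel_dist R r x"
proof -
  have fe: "finite (rel_dist R r ` V)" "rel_dist R r ` V \<noteq> {}" using finite_verts assms by auto
  then obtain x where x: "x \<in> V" "rel_dist R r x = Max (rel_dist R r ` V)" using Max_in[OF fe] by (metis imageE)
  then show thesis using that fe by (metis Max_ge image_eqI)
qed

text \<open>Predecessors on a shortest walk from \<open>r\<close> are strictly closer to
  \<open>r\<close> than its end, so such a walk to another vertex avoids the farthest vertex
  \<open>x\<close>.\<close>

lemma connected_graph_del_farthest:
  assumes r: "r \<in> V" and x: "x \<in> V" "x \<noteq> r" "\<And>y. y \<in> V \<Longrightarrow> rel_dist R r y \<le> rel_dist R r x"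
  shows "connected_graph (V - {x}) (del_vertex x R)"
proof
  show s: "sym (del_vertex x R)" using sym_arcs by (auto simp: del_vertex_def sym_def)
  have "(r, y) \<in> (del_vertex x R)\<^sup>*" if "y \<in> V - {x}" for y
    using that
  proof (induction "rel_dist R r y" arbitrary: y)
    case 0
    then show ?case using rel_dist_eq_0_iff r by auto
  next
    case (Suc k)
    obtain w where w: "w \<in> V" "(w, y) \<in> R" "rel_dist R r w = k"
      using rel_dist_pred[OF r _ Suc.hyps(2)[symmetric]] Suc.prems by blast
    then have "w \<noteq> x" using x(3)[of y] Suc by auto
    then have "(r, w) \<in> (del_vertex x R)\<^sup>*" using w Suc by auto
    moreover have "(w, y) \<in> del_vertex x R" using w Suc \<open>w \<noteq> x\<close> by (auto simp: del_vertex_def)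
    ultimately show ?case by (rule rtrancl.rtrancl_into_rtrancl)
  qed
  then show "(u, v) \<in> (del_vertex x R)\<^sup>*" if "u \<in> V - {x}" "v \<in> V - {x}" for u v
    using that sym_rtrancl[OF s] by (meson rtrancl_trans symD)
qed (use finite_verts arcD in \<open>auto simp: del_vertex_def\<close>)

lemma non_cut_vertex:
  assumes "card V \<ge> 2"
  obtains x where "x \<in> V" "connected_graph (V - {x}) (del_vertex x R)"
proof -
  from assms have "V \<noteq> {}" by auto
  then obtain r where r: "r \<in> V" by auto
  then obtain s where s: "s \<in> V" "s \<noteq> r" using assms
    by (metis card_2_iff' obtain_subset_with_card_n subsetD)
  obtain x where x: "x \<in> V" "\<And>y. y \<in> V \<Longrightarrow> rel_dist R r y \<le> rel_dist R r x"
    using farthest_exists[OF r] by blast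
  then have "x \<noteq> r" using x(2)[OF s(1)] rel_dist_pos[OF r s(1)] s by auto
  then show thesis using that connected_graph_del_farthest r x by blast
qed

lemma rel_dist_del_vertex_ge:
  assumes "connected_graph (V - {x}) (del_vertex x R)" "u \<in> V - {x}" "v \<in> V - {x}"
  shows "rel_dist R u v \<le> rel_dist (del_vertex x R) u v"
  by (rule rel_dist_le[OF subsetD[OF relpow_subset_mono[OF del_vertex_subset] connected_graph.rel_dist_relpow[OF assms]]])

lemma card_del_vertex:
  assumes "x \<in> V"
  shows "card R = card (del_vertex x R) + 2 * card (R `` {x})"
proof -
  have fN: "finite (R `` {x})" using finite_arcs by (simp add: finite_Image)
  have "R = del_vertex x R \<union> ({x} \<times> R `` {x} \<union> R `` {x} \<times> {x})"
    using arcD by (auto simp: del_vertex_def)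
  moreover have "card \<dots> = card (del_vertex x R) + card ({x} \<times> R `` {x} \<union> R `` {x} \<times> {x})"
    using fN finite_subset[OF del_vertex_subset finite_arcs]
    by (intro card_Un_disjoint) (auto simp: del_vertex_def)
  moreover have "card ({x} \<times> R `` {x} \<union> R `` {x} \<times> {x}) = card ({x} \<times> R `` {x}) + card (R `` {x} \<times> {x})"
    using fN no_loop by (intro card_Un_disjoint) auto
  ultimately show ?thesis by (simp add: card_cartesian_product)
qed

text \<open>If each level has at most one vertex, every arc joins consecutive levels. An arc leading
  away from \<open>r\<close> is determined by its head, which is not \<open>r\<close>; the factor 2
  accounts for the reverse arcs.\<close>

lemma card_arcs_inj_levels:
  assumes r: "r \<in> V" and inj: "inj_on (rel_dist R r) V"
  shows "card R \<le> 2 * (card V - 1)"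
proof -
  let ?U = "{(a, b) \<in> R. rel_dist R r b = Suc (rel_dist R r a)}"
  have "rel_dist R r b = Suc (rel_dist R r a) \<or> rel_dist R r a = Suc (rel_dist R r b)" if "(a, b) \<in> R" for a b
    using rel_dist_arc_le[OF r, of a b] rel_dist_arc_le[OF r, of b a] arcD[OF that] that
      inj_onD[OF inj, of a b] by fastforce
  then have "R \<subseteq> ?U \<union> ?U\<inverse>" using arcD by fast
  then have "card R \<le> card (?U \<union> ?U\<inverse>)" using finite_arcs by (intro card_mono) (auto intro: finite_subset[of ?U R])
  also have "\<dots> \<le> card ?U + card (?U\<inverse>)" by (rule card_Un_le)
  also have "card (?U\<inverse>) = card ?U" by simp
  finally have "card R \<le> 2 * card ?U" by simp
  moreover have "card ?U \<le> card (V - {r})"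
  proof (rule card_inj_on_le)
    show "inj_on snd ?U" using inj arcD by (auto simp: inj_on_def)
    show "snd ` ?U \<subseteq> V - {r}" using arcD by auto
  qed (use finite_verts in auto)
  ultimately show ?thesis using r finite_verts by simp
qed

lemma the_rel_dist: "(THE d. \<exists>x y. {u, v} = {x, y} \<and> d = rel_dist R x y) = rel_dist R u v"
  by (rule the_equality) (auto simp: doubleton_eq_iff rel_dist_sym)

lemma wiener_sum_remove:
  assumes "x \<in> V"
  shows "wiener_sum h V R = (\<Sum>e\<in>pairs (V - {x}). h (THE d. \<exists>u v. e = {u, v} \<and> d = rel_dist R u v))
    + (\<Sum>u\<in>V - {x}. h (rel_dist R x u))"
  unfolding wiener_sum_def
  using sum_pairs_remove[OF finite_verts assms, of "\<lambda>e. h (THE d. \<exists>u v. e = {u, v} \<and> d = rel_dist R u v)"]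
  by (simp add: the_rel_dist)

text \<open>The induction step of both upper bounds: distances among the remaining vertices can only
  grow, and the contribution of \<open>x\<close> splits off.\<close>

lemma wiener_sum_del_vertex_le:
  assumes h: "strict_mono_on {1..} h" and x: "x \<in> V" "connected_graph (V - {x}) (del_vertex x R)"
  shows "wiener_sum h V R \<le> wiener_sum h (V - {x}) (del_vertex x R) + (\<Sum>u\<in>V - {x}. h (rel_dist R x u))"
proof -
  interpret D: connected_graph "V - {x}" "del_vertex x R" by fact
  have "(\<Sum>e\<in>pairs (V - {x}). h (THE d. \<exists>u v. e = {u, v} \<and> d = rel_dist R u v))
    \<le> wiener_sum h (V - {x}) (del_vertex x R)"
    unfolding wiener_sum_def
  proof (rule sum_mono)
    fix e assume "e \<in> pairs (V - {x})"
    then obtain a b where e: "e = {a, b}" "a \<noteq> b" "a \<in> V - {x}" "b \<in> V - {x}"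
      by (auto simp: pairs_def card_2_iff)
    then have "h (rel_dist R a b) \<le> h (rel_dist (del_vertex x R) a b)"
      using rel_dist_del_vertex_ge[OF x(2)] rel_dist_pos[of a b] D.rel_dist_pos[of a b]
      by (intro strict_mono_on_leD[OF h]) auto
    then show "h (THE d. \<exists>u v. e = {u, v} \<and> d = rel_dist R u v)
      \<le> h (THE d. \<exists>u v. e = {u, v} \<and> d = rel_dist (del_vertex x R) u v)"
      unfolding e(1) by (simp only: the_rel_dist D.the_rel_dist)
  qed
  then show ?thesis using wiener_sum_remove[OF x(1)] by simp
qed

end

section \<open>The upper bound\<close>

text \<open>The Wiener index of a path on \<open>m\<close> vertices, in which \<open>m - j\<close>
  pairs have distance \<open>j\<close>.\<close>

definition path_value :: "(nat \<Rightarrow> real) \<Rightarrow> nat \<Rightarrow> real" where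
  "path_value h m = (\<Sum>j=1..m - 1. (real m - real j) * h j)"

text \<open>The upper bound of the theorem for increasing \<open>h\<close>: a triangle with a
  pendant path has \<open>n\<close> pairs at distance 1 and \<open>n - j\<close> pairs at each
  distance \<open>j\<close> from 2 to \<open>n - 2\<close>.\<close>

definition lollipop_value :: "(nat \<Rightarrow> real) \<Rightarrow> nat \<Rightarrow> real" where
  "lollipop_value h n = real n * h 1 + (\<Sum>j=2..n - 2. (real n - real j) * h j)"

text \<open>A new end of a path sees the \<open>m\<close> old vertices at distances
  \<open>1, ..., m\<close>.\<close>

lemma path_value_Suc:
  assumes "m \<ge> 1"
  shows "path_value h (Suc m) = path_value h m + (\<Sum>j=1..m. h j)"
proof -
  obtain k where m: "m = Suc k" using assms by (cases m) auto
  have "(\<Sum>j=1..k. (real (Suc m) - real j) * h j) = (\<Sum>j=1..k. (real m - real j) * h j) + (\<Sum>j=1..k. h j)"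
    by (simp add: sum.distrib[symmetric] algebra_simps)
  then show ?thesis by (simp add: path_value_def m algebra_simps)
qed

text \<open>A vertex appended to the tail sees the old vertices at distances
  \<open>1, ..., n - 1\<close>, the last one twice because of the two far triangle vertices.\<close>

lemma lollipop_value_Suc:
  assumes "n \<ge> 3"
  shows "lollipop_value h (Suc n) = lollipop_value h n + (\<Sum>j=1..n - 1. h j) + h (n - 1)"
proof -
  obtain k where n: "n = Suc (Suc (Suc k))" using assms
    by (metis Suc_le_D numeral_3_eq_3 Suc_le_mono)
  have "(\<Sum>j=2..Suc k. (real (Suc n) - real j) * h j)
      = (\<Sum>j=2..Suc k. (real n - real j) * h j) + (\<Sum>j=2..Suc k. h j)"
    by (simp add: sum.distrib[symmetric] algebra_simps)
  moreover have "(\<Sum>j=1..Suc (Suc k). h j) = h 1 + (\<Sum>j=2..Suc k. h j) + h (Suc (Suc k))"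
    by (simp add: sum.atLeast_Suc_atMost numeral_2_eq_2)
  moreover have "(\<Sum>j=2..Suc (Suc k). (real (Suc n) - real j) * h j)
      = (\<Sum>j=2..Suc k. (real (Suc n) - real j) * h j) + 2 * h (Suc (Suc k))"
    by (simp add: n)
  ultimately show ?thesis by (simp add: lollipop_value_def n algebra_simps)
qed

text \<open>The same graph as a path on \<open>n\<close> vertices plus a vertex adjacent to its
  first two, which has distances \<open>1, 1, 2, ..., n - 1\<close>.\<close>

lemma lollipop_value_path:
  assumes "n \<ge> 2"
  shows "lollipop_value h (Suc n) = path_value h n + h 1 + (\<Sum>j=1..n - 1. h j)"
proof -
  obtain k where n: "n = Suc (Suc k)" using assms
    by (metis Suc_le_D numeral_2_eq_2 Suc_le_mono)
  have "path_value h n + (\<Sum>j=1..n - 1. h j) = (\<Sum>j=1..Suc k. (real (Suc n) - real j) * h j)"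
    by (simp add: path_value_def n sum.distrib[symmetric] algebra_simps)
  also have "\<dots> = real n * h 1 + (\<Sum>j=2..Suc k. (real (Suc n) - real j) * h j)"
  proof -
    have "{1..Suc k} = insert 1 {2..Suc k}" by auto
    then show ?thesis by simp
  qed
  finally show ?thesis by (simp add: lollipop_value_def n algebra_simps)
qed

text \<open>Non-cut vertices are deleted one by one; when \<open>m\<close> vertices remain, the
  deleted one contributes at most \<open>h 1 + ... + h m\<close>.\<close>

lemma (in connected_graph) wiener_sum_le_path:
  assumes "strict_mono_on {1..} h" "V \<noteq> {}"
  shows "wiener_sum h V R \<le> path_value h (card V)"
  using connected_graph_axioms assms(2)
proof (induction "card V" arbitrary: V R)
  case 0
  then show ?case by (simp add: connected_graph.finite_verts)
next
  case (Suc m V R)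
  interpret connected_graph V R by fact
  show ?case
  proof (cases "m = 0")
    case True
    have "card e \<noteq> 2" if "e \<subseteq> V" for e
      using card_mono[OF finite_verts that] True Suc.hyps(2) by simp
    then have "pairs V = {}" by (auto simp: pairs_def)
    then show ?thesis using True Suc.hyps(2)[symmetric] by (simp add: wiener_sum_def path_value_def)
  next
    case False
    then have m: "m \<ge> 1" "card V = Suc m" using Suc by auto
    then obtain x where x: "x \<in> V" "connected_graph (V - {x}) (del_vertex x R)"
      using non_cut_vertex by auto
    have c: "card (V - {x}) = m" using x m by simp
    have "V - {x} \<noteq> {}" using c m by (metis card.empty le_zero_eq zero_neq_numeral zero_neq_one)
    with Suc.hyps(1)[OF c[symmetric] x(2)] c
    have "wiener_sum h (V - {x}) (del_vertex x R) \<le> path_value h m" by simp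
    moreover obtain e where e: "rel_dist R x ` (V - {x}) = {1..e}" using levels[OF x(1)] by blast
    have "(\<Sum>u\<in>V - {x}. h (rel_dist R x u)) \<le> (\<Sum>j=1..m. h j)"
      using level_sum_le[OF assms(1) _ e] finite_verts c by simp
    ultimately show ?thesis using wiener_sum_del_vertex_le[OF assms(1) x] path_value_Suc[OF m(1), of h] m(2) by simp
  qed
qed

context connected_graph begin

text \<open>Single-vertex levels would leave at most \<open>card V - 1\<close> edges.\<close>

lemma not_inj_levels:
  assumes "2 * card V \<le> card R" "r \<in> V"
  shows "\<not> inj_on (rel_dist R r) (V - {r})"
proof
  assume "inj_on (rel_dist R r) (V - {r})"
  moreover have "rel_dist R r r \<notin> rel_dist R r ` (V - {r})" using rel_dist_pos assms(2) by force
  ultimately have "inj_on (rel_dist R r) V" using assms(2) 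
    by (metis inj_on_insert insert_Diff Diff_idemp)
  from card_arcs_inj_levels[OF assms(2) this] assms have "card V = 0" by simp
  then show False using assms(2) finite_verts by auto
qed

lemma card_arcs_le: "card R \<le> card V * (card V - 1)"
proof -
  have "card R \<le> card (Sigma V (\<lambda>a. V - {a}))"
    using finite_verts arcD by (intro card_mono) auto
  also have "\<dots> = (\<Sum>a\<in>V. card V - 1)"
    using finite_verts by (subst card_SigmaI) auto
  finally show ?thesis by simp
qed

lemma card_ge_3:
  assumes "2 * card V \<le> card R" "V \<noteq> {}"
  shows "card V \<ge> 3"
proof (rule ccontr)
  assume "\<not> 3 \<le> card V"
  then have "card V = 0 \<or> card V = 1 \<or> card V = 2" by auto
  moreover have "card V > 0" using assms finite_verts by (simp add: card_gt_0_iff)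
  ultimately show False using card_arcs_le assms by auto
qed

text \<open>Two neighbours of \<open>x\<close> share level 1, so the bounds for a doubled first
  level apply.\<close>

lemma degree_two_sum:
  fixes h :: "nat \<Rightarrow> real"
  assumes h: "strict_mono_on {1..} h" and x: "x \<in> V" "card (R `` {x}) \<ge> 2"
  shows "(\<Sum>u\<in>V - {x}. h (rel_dist R x u)) \<le> h 1 + (\<Sum>j=1..card V - 2. h j)"
    and "(\<Sum>u\<in>V - {x}. h (rel_dist R x u)) = h 1 + (\<Sum>j=1..card V - 2. h j) \<Longrightarrow>
      \<exists>a. (x, a) \<in> R \<and> inj_on (rel_dist R x) (V - {x} - {a})"
proof -
  obtain a b where ab: "a \<noteq> b" "(x, a) \<in> R" "(x, b) \<in> R"
    using x(2) card_le_Suc0_iff_eq[OF finite_Image[OF finite_arcs, of "{x}"]] by auto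
  then have l: "a \<in> V - {x}" "b \<in> V - {x}" "a \<noteq> b" "rel_dist R x a = 1" "rel_dist R x b = 1"
    using arcD[of x a] arcD[of x b] rel_dist_eq_1_iff by auto
  obtain e where e: "rel_dist R x ` (V - {x}) = {1..e}" using levels[OF x(1)] by blast
  have f: "finite (V - {x})" using finite_verts by simp
  have c: "card (V - {x}) - 1 = card V - 2" using x(1) finite_verts by simp
  show "(\<Sum>u\<in>V - {x}. h (rel_dist R x u)) \<le> h 1 + (\<Sum>j=1..card V - 2. h j)"
    using level_sum_le_two_first(1)[OF h f e l] unfolding c .
  show "\<exists>a. (x, a) \<in> R \<and> inj_on (rel_dist R x) (V - {x} - {a})"
    if "(\<Sum>u\<in>V - {x}. h (rel_dist R x u)) = h 1 + (\<Sum>j=1..card V - 2. h j)"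
    using level_sum_le_two_first(2)[OF h f e l] that ab(2) unfolding c by blast
qed

end

text \<open>Either some deletion leaves at least as many edges as vertices, and the recursion along
  the tail applies, or every non-cut vertex has at least two neighbours, and the rest is compared
  with a path.\<close>

lemma (in connected_graph) wiener_sum_le_lollipop:
  assumes h: "strict_mono_on {1..} h" and "2 * card V \<le> card R" "V \<noteq> {}"
  shows "wiener_sum h V R \<le> lollipop_value h (card V)"
  using connected_graph_axioms assms(2,3)
proof (induction "card V" arbitrary: V R)
  case 0
  then show ?case by (simp add: connected_graph.finite_verts)
next
  case (Suc n V R)
  interpret connected_graph V R by fact
  have n: "n \<ge> 2" "card V = Suc n" using card_ge_3[OF Suc.prems(2,3)] Suc.hyps(2) by auto
  show ?case
  proof (cases "\<exists>x\<in>V. connected_graph (V - {x}) (del_vertex x R) \<and> 2 * n \<le> card (del_vertex x R)")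
    case True
    then obtain x where x: "x \<in> V" "connected_graph (V - {x}) (del_vertex x R)" "2 * n \<le> card (del_vertex x R)" by blast
    interpret D: connected_graph "V - {x}" "del_vertex x R" by fact
    have c: "card (V - {x}) = n" using x n by simp
    have ne: "V - {x} \<noteq> {}" using c n by (metis card.empty le_zero_eq zero_neq_numeral zero_neq_one)
    then have "n \<ge> 3" using D.card_ge_3 x c by simp
    obtain e where e: "rel_dist R x ` (V - {x}) = {1..e}" using levels[OF x(1)] by blast
    have "(\<Sum>u\<in>V - {x}. h (rel_dist R x u)) \<le> (\<Sum>j=1..n - 1. h j) + h (n - 1)"
      using level_sum_le_not_inj[OF h D.finite_verts e not_inj_levels[OF Suc.prems(2) x(1)]]
      unfolding c by blast
    moreover have "wiener_sum h (V - {x}) (del_vertex x R) \<le> lollipop_value h n"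
      using Suc.hyps(1)[OF c[symmetric] x(2)] x(3) c ne by simp
    ultimately show ?thesis
      using wiener_sum_del_vertex_le[OF h x(1,2)] lollipop_value_Suc[OF \<open>n \<ge> 3\<close>, of h] n(2) by simp
  next
    case False
    obtain x where x: "x \<in> V" "connected_graph (V - {x}) (del_vertex x R)"
      using non_cut_vertex n by auto
    interpret D: connected_graph "V - {x}" "del_vertex x R" by fact
    have c: "card (V - {x}) = n" using x n by simp
    have ne: "V - {x} \<noteq> {}" using c n by (metis card.empty le_zero_eq zero_neq_numeral zero_neq_one)
    have "card (del_vertex x R) < 2 * n" using False x by auto
    \<comment> \<open>Of at least \<open>n + 1\<close> edges fewer than \<open>n\<close> remain, so
      \<open>x\<close> lies on at least two.\<close>
    then have "card (R `` {x}) \<ge> 2" using card_del_vertex[OF x(1)] Suc.prems(2) n(2) by simp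
    from degree_two_sum(1)[OF h x(1) this]
    have "(\<Sum>u\<in>V - {x}. h (rel_dist R x u)) \<le> h 1 + (\<Sum>j=1..n - 1. h j)" using n by simp
    moreover have "wiener_sum h (V - {x}) (del_vertex x R) \<le> path_value h n"
      using D.wiener_sum_le_path[OF h ne] c by simp
    ultimately show ?thesis
      using wiener_sum_del_vertex_le[OF h x] lollipop_value_path[OF n(1), of h] n(2) by simp
  qed
qed

text \<open>Every level from \<open>r\<close> is a single vertex except the last one, which
  \<open>x\<close> shares with one other vertex; these two become the far side of the
  triangle.\<close>

lemma (in connected_graph) wiener_sum_eq_lollipop_levels:
  assumes h: "strict_mono_on {1..} h" and R: "2 * card V \<le> card R" and n5: "card V \<ge> 5"
    and eq: "wiener_sum h V R = lollipop_value h (card V)"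
  obtains r x where "r \<in> V" "x \<in> V" "x \<noteq> r" "rel_dist R r x = card V - 2"
    "bij_betw (rel_dist R r) (V - {x}) {0..card V - 2}"
proof -
  obtain n where n: "card V = Suc n" "n \<ge> 4" using n5 by (cases "card V") auto
  let ?good = "\<lambda>x. x \<in> V \<and> connected_graph (V - {x}) (del_vertex x R) \<and> 2 * n \<le> card (del_vertex x R)"
  have "\<exists>x. ?good x"
  proof (rule ccontr)
    \<comment> \<open>In the absence of such a vertex, equality must hold in the bound on the
      contribution of any non-cut vertex \<open>x\<close>. This produces a leaf, whose deletion is
      good after all.\<close>
    assume bad: "\<not> (\<exists>x. ?good x)"
    obtain x where x: "x \<in> V" "connected_graph (V - {x}) (del_vertex x R)"
      using non_cut_vertex n by auto
    interpret D: connected_graph "V - {x}" "del_vertex x R" by fact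
    have c: "card (V - {x}) = n" using x n by simp
    have ne: "V - {x} \<noteq> {}" using c n by (metis card.empty le_zero_eq zero_neq_numeral zero_neq_one)
    have "card (del_vertex x R) < 2 * n" using bad x by (meson not_le)
    then have deg: "card (R `` {x}) \<ge> 2" using card_del_vertex[OF x(1)] R n by simp
    have "wiener_sum h (V - {x}) (del_vertex x R) \<le> path_value h n"
      using D.wiener_sum_le_path[OF h ne] c by simp
    then have "(\<Sum>u\<in>V - {x}. h (rel_dist R x u)) \<ge> h 1 + (\<Sum>j=1..n - 1. h j)"
      using wiener_sum_del_vertex_le[OF h x] lollipop_value_path[of n h] n eq by simp
    then have "(\<Sum>u\<in>V - {x}. h (rel_dist R x u)) = h 1 + (\<Sum>j=1..card V - 2. h j)"
      using degree_two_sum(1)[OF h x(1) deg] n by simp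
    then obtain a where a: "(x, a) \<in> R" and inj: "inj_on (rel_dist R x) (V - {x} - {a})"
      using degree_two_sum(2)[OF h x(1) deg] by blast
    have aV: "a \<in> V" "a \<noteq> x" "rel_dist R x a = 1" using arcD[OF a] a rel_dist_eq_1_iff by auto
    obtain y where y: "y \<in> V" "\<And>z. z \<in> V \<Longrightarrow> rel_dist R x z \<le> rel_dist R x y"
      using farthest_exists[OF x(1)] by blast
    have cd: "card (V - {x} - {a}) = n - 1" using aV c by simp
    \<comment> \<open>The \<open>n - 1\<close> vertices other than \<open>x\<close> and
      \<open>a\<close> lie on distinct levels, so the farthest one has level at least
      \<open>n - 1\<close>, which is at least 3.\<close>
    have "rel_dist R x ` (V - {x} - {a}) \<subseteq> {1..rel_dist R x y}"
      using y(2) rel_dist_pos[OF x(1)] by force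
    from card_inj_on_le[OF inj this] cd have dy: "rel_dist R x y \<ge> 3" using n(2) by simp
    then have "y \<noteq> x" "y \<noteq> a" using aV by auto
    \<comment> \<open>\<open>y\<close> is alone on the last level, and \<open>a\<close> on level 1
      is too far away to be adjacent to it, so all neighbours of \<open>y\<close> lie on the level
      before.\<close>
    have N: "R `` {y} \<subseteq> {z \<in> V - {x} - {a}. rel_dist R x z = rel_dist R x y - 1}"
    proof
      fix z assume "z \<in> R `` {y}"
      then have z: "(y, z) \<in> R" by simp
      then have "rel_dist R x y \<le> Suc (rel_dist R x z)" using rel_dist_arc_le[OF x(1), of z y] arcD by blast
      then have "z \<noteq> x" "z \<noteq> a" using dy aV by auto
      have "rel_dist R x z \<noteq> rel_dist R x y"
        using inj_onD[OF inj, of z y] arcD[OF z] \<open>z \<noteq> x\<close> \<open>z \<noteq> a\<close> \<open>y \<noteq> x\<close> \<open>y \<noteq> a\<close> by auto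
      then have "rel_dist R x z = rel_dist R x y - 1"
        using y(2)[of z] arcD[OF z] \<open>rel_dist R x y \<le> Suc (rel_dist R x z)\<close> by simp
      then show "z \<in> {z \<in> V - {x} - {a}. rel_dist R x z = rel_dist R x y - 1}"
        using arcD[OF z] \<open>z \<noteq> x\<close> \<open>z \<noteq> a\<close> by simp
    qed
    then have "inj_on (rel_dist R x) (R `` {y})" by (intro inj_on_subset[OF inj]) auto
    moreover have "rel_dist R x ` (R `` {y}) \<subseteq> {rel_dist R x y - 1}" using N by auto
    ultimately have "card (R `` {y}) \<le> 1"
      using card_inj_on_le[of "rel_dist R x" "R `` {y}" "{rel_dist R x y - 1}"] by simp
    \<comment> \<open>Deleting the leaf \<open>y\<close> costs only one edge.\<close>
    then have "2 * n \<le> card (del_vertex y R)" using card_del_vertex[OF y(1)] R n by simp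
    moreover have "connected_graph (V - {y}) (del_vertex y R)"
      using connected_graph_del_farthest x(1) y \<open>y \<noteq> x\<close> by blast
    ultimately show False using bad y(1) by blast
  qed
  then obtain r where r: "r \<in> V" "connected_graph (V - {r}) (del_vertex r R)" "2 * n \<le> card (del_vertex r R)" by blast
  interpret D: connected_graph "V - {r}" "del_vertex r R" by fact
  have c: "card (V - {r}) = n" using r n by simp
  have ne: "V - {r} \<noteq> {}" using c n by (metis card.empty le_zero_eq zero_neq_numeral zero_neq_one)
  have "wiener_sum h (V - {r}) (del_vertex r R) \<le> lollipop_value h n"
    using D.wiener_sum_le_lollipop[OF h _ ne] r(3) c by simp
  \<comment> \<open>The rest takes at most \<open>lollipop_value h n\<close>, so equality leaves no
    slack in the contribution of \<open>r\<close>.\<close>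
  then have ge: "(\<Sum>u\<in>V - {r}. h (rel_dist R r u)) \<ge> (\<Sum>j=1..n - 1. h j) + h (n - 1)"
    using wiener_sum_del_vertex_le[OF h r(1,2)] lollipop_value_Suc[of n h] n eq by simp
  obtain e where e: "rel_dist R r ` (V - {r}) = {1..e}" using levels[OF r(1)] by blast
  obtain x where x: "x \<in> V - {r}" "rel_dist R r x = n - 1" "bij_betw (rel_dist R r) (V - {r} - {x}) {1..n - 1}"
    using level_sum_le_not_inj[OF h D.finite_verts e not_inj_levels[OF R r(1)]] finite_verts ge c by auto
  have "V - {x} = insert r (V - {r} - {x})" using x r by auto
  moreover have "{0..n - 1} = insert 0 {1..n - 1}" by auto
  moreover have "bij_betw (rel_dist R r) (insert r (V - {r} - {x})) (insert 0 {1..n - 1})"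
    using x(3) unfolding bij_betw_def by auto
  ultimately have "bij_betw (rel_dist R r) (V - {x}) {0..n - 1}" by simp
  then show thesis using that[of r x] r x n by simp
qed

section \<open>The extremal graph of the upper bound\<close>

lemma relpow_image_iff:
  assumes inj: "inj_on f V" and R: "R \<subseteq> V \<times> V" and uv: "u \<in> V" "v \<in> V"
  shows "(f u, f v) \<in> (map_prod f f ` R) ^^ k \<longleftrightarrow> (u, v) \<in> R ^^ k"
  using uv(2)
proof (induction k arbitrary: v)
  case 0
  then show ?case using inj uv by (auto dest: inj_onD)
next
  case (Suc k)
  show ?case
  proof
    assume "(f u, f v) \<in> (map_prod f f ` R) ^^ Suc k"
    then obtain w a b where "(f u, w) \<in> (map_prod f f ` R) ^^ k" "(a, b) \<in> R" "w = f a" "f v = f b"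
      by auto
    moreover have "a \<in> V" "b = v" using calculation R Suc.prems inj by (auto dest: inj_onD)
    ultimately show "(u, v) \<in> R ^^ Suc k" using Suc.IH by auto
  next
    assume "(u, v) \<in> R ^^ Suc k"
    then obtain w where w: "(u, w) \<in> R ^^ k" "(w, v) \<in> R" by auto
    then have "(f u, f w) \<in> (map_prod f f ` R) ^^ k" using Suc.IH R by auto
    moreover have "(f w, f v) \<in> map_prod f f ` R" using w(2) by force
    ultimately show "(f u, f v) \<in> (map_prod f f ` R) ^^ Suc k" by (rule relpow_Suc_I)
  qed
qed

lemma rel_dist_image:
  assumes "inj_on f V" "R \<subseteq> V \<times> V" "u \<in> V" "v \<in> V"
  shows "rel_dist (map_prod f f ` R) (f u) (f v) = rel_dist R u v"
  unfolding rel_dist_def using relpow_image_iff[OF assms] by simp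

lemma bij_betw_pairs:
  assumes "bij_betw f V W"
  shows "bij_betw ((`) f) (pairs V) (pairs W)"
proof (rule bij_betw_subset[OF bij_betw_Pow[OF assms]])
  show "pairs V \<subseteq> Pow V" by (auto simp: pairs_def)
  have inj: "inj_on f V" and W: "f ` V = W" using assms by (auto simp: bij_betw_def)
  have "card (f ` e) = card e" if "e \<subseteq> V" for e
    using card_image inj_on_subset[OF inj that] by blast
  then show "(`) f ` pairs V = pairs W"
    unfolding pairs_def W[symmetric] by (auto simp: image_iff subset_image_iff intro: image_mono)
qed

context connected_graph
begin

lemma connected_graph_image:
  assumes f: "bij_betw f V W"
  shows "connected_graph W (map_prod f f ` R)"
proof -
  have inj: "inj_on f V" and W: "W = f ` V" using f by (auto simp: bij_betw_def)
  show ?thesis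
  proof
    show "finite W" using finite_verts W by simp
    show "map_prod f f ` R \<subseteq> W \<times> W" using arcs_subset W by auto
    show "sym (map_prod f f ` R)" using arcD by (fastforce simp: sym_def)
    show "(x, x) \<notin> map_prod f f ` R" for x using arcD inj by (auto dest: inj_onD)
    show "(u, v) \<in> (map_prod f f ` R)\<^sup>*" if uv: "u \<in> W" "v \<in> W" for u v
    proof -
      obtain a b where ab: "a \<in> V" "b \<in> V" "u = f a" "v = f b" using uv W by auto
      then show ?thesis using relpow_image_iff[OF inj arcs_subset ab(1,2)] rel_dist_relpow[OF ab(1,2)]
        by (metis relpow_imp_rtrancl)
    qed
  qed
qed

lemma wiener_sum_image:
  assumes f: "bij_betw f V W"
  shows "wiener_sum h W (map_prod f f ` R) = wiener_sum h V R"
proof -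
  interpret I: connected_graph W "map_prod f f ` R" by (rule connected_graph_image[OF f])
  have inj: "inj_on f V" using f by (auto simp: bij_betw_def)
  let ?\<phi> = "\<lambda>S e. h (THE d. \<exists>u v. e = {u, v} \<and> d = rel_dist S u v)"
  have "wiener_sum h V R = (\<Sum>e\<in>pairs V. ?\<phi> (map_prod f f ` R) (f ` e))"
    unfolding wiener_sum_def
  proof (rule sum.cong[OF refl])
    fix e assume "e \<in> pairs V"
    then obtain a b where e: "e = {a, b}" "a \<in> V" "b \<in> V" by (auto simp: pairs_def card_2_iff)
    then have "f ` e = {f a, f b}" by auto
    then show "?\<phi> R e = ?\<phi> (map_prod f f ` R) (f ` e)"
      unfolding e(1) using rel_dist_image[OF inj arcs_subset e(2,3)] by (simp only: I.the_rel_dist the_rel_dist)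
  qed
  also have "\<dots> = wiener_sum h W (map_prod f f ` R)"
    unfolding wiener_sum_def by (rule sum.reindex_bij_betw[OF bij_betw_pairs[OF f]])
  finally show ?thesis by simp
qed

text \<open>Counting replaces the second inclusion: the image has at least \<open>2 * card V\<close>
  arcs, and \<open>A\<close> with its converse has at most that many.\<close>

lemma arcs_image_eqI:
  assumes f: "bij_betw f V W" and R: "2 * card V \<le> card R"
    and A: "finite A" "card A \<le> card V" "map_prod f f ` R \<subseteq> A \<union> A\<inverse>"
  shows "map_prod f f ` R = A \<union> A\<inverse>"
proof (rule card_seteq)
  have "inj_on (map_prod f f) R"
    using f arcs_subset map_prod_inj_on inj_on_subset unfolding bij_betw_def by metis
  then have "card (map_prod f f ` R) = card R" by (rule card_image)
  moreover have "card (A \<union> A\<inverse>) \<le> card A + card (A\<inverse>)" by (rule card_Un_le)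
  ultimately show "card (A \<union> A\<inverse>) \<le> card (map_prod f f ` R)"
    using A(2) R by simp
qed (use A in auto)

end

text \<open>One orientation of each edge: the path \<open>1, ..., n - 1\<close> with an extra vertex
  0 joined to 1 and 2.\<close>

definition lollipop_arcs :: "nat \<Rightarrow> nat rel" where
  "lollipop_arcs n = {(0, 1), (0, 2)} \<union> (\<lambda>i. (i, Suc i)) ` {1..<n - 1}"

definition triangle_star_arcs :: "nat \<Rightarrow> nat rel" where
  "triangle_star_arcs n = {(0, 1), (0, 2), (1, 2)} \<union> Pair 2 ` {3..<n}"

lemma finite_lollipop_arcs: "finite (lollipop_arcs n)"
  by (simp add: lollipop_arcs_def)

lemma finite_triangle_star_arcs: "finite (triangle_star_arcs n)"
  by (simp add: triangle_star_arcs_def)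

lemma card_lollipop_arcs: "3 \<le> n \<Longrightarrow> card (lollipop_arcs n) \<le> n"
  unfolding lollipop_arcs_def
  by (rule order_trans[OF card_Un_le])
    (use card_image_le[of "{1..<n - 1}" "\<lambda>i. (i, Suc i)"] in simp)

lemma card_triangle_star_arcs: "3 \<le> n \<Longrightarrow> card (triangle_star_arcs n) \<le> n"
  unfolding triangle_star_arcs_def
  by (rule order_trans[OF card_Un_le])
    (use card_image_le[of "{3..<n}" "Pair (2::nat)"] in simp)

text \<open>Vertices are numbered by level, counted back from the far end: the root gets
  \<open>n - 1\<close>, and the two vertices of the last level get 1 and, for \<open>x\<close>, 0.
  Counting arcs then shows that nothing is missing.\<close>

lemma (in connected_graph) wiener_sum_eq_lollipop_iso:
  assumes h: "strict_mono_on {1..} h" and R: "2 * card V \<le> card R" and n5: "card V \<ge> 5"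
    and eq: "wiener_sum h V R = lollipop_value h (card V)"
  shows "\<exists>f. bij_betw f V {0..<card V} \<and>
    map_prod f f ` R = lollipop_arcs (card V) \<union> (lollipop_arcs (card V))\<inverse>"
proof -
  define n where "n = card V"
  have n: "n \<ge> 5" using n5 n_def by simp
  obtain r x where rx: "r \<in> V" "x \<in> V" "x \<noteq> r" "rel_dist R r x = n - 2"
    and b: "bij_betw (rel_dist R r) (V - {x}) {0..n - 2}"
    using wiener_sum_eq_lollipop_levels[OF h R n5 eq] unfolding n_def by blast
  define f where "f v = (if v = x then 0 else n - 1 - rel_dist R r v)" for v
  have "bij_betw (\<lambda>k. n - 1 - k) {0..n - 2} {1..n - 1}"
    using n by (intro bij_betw_byWitness[where f' = "\<lambda>k. n - 1 - k"]) auto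
  from bij_betw_trans[OF b this] have "bij_betw (\<lambda>v. n - 1 - rel_dist R r v) (V - {x}) {1..n - 1}"
    by (simp add: comp_def)
  then have f1: "bij_betw f (V - {x}) {1..n - 1}"
    by (rule bij_betw_cong[THEN iffD1, rotated]) (auto simp: f_def)
  have "f x = 0" by (simp add: f_def)
  then have "bij_betw f (insert x (V - {x})) (insert 0 {1..n - 1})"
    using notIn_Un_bij_betw[of x "V - {x}" f "{1..n - 1}"] f1 by simp
  moreover have "insert 0 {1..n - 1} = {0..<n}" using n by auto
  ultimately have f: "bij_betw f V {0..<n}" using rx(2) by (simp add: insert_absorb)
  have le: "rel_dist R r v \<le> n - 2" if "v \<in> V" for v
    using that b rx(4) unfolding bij_betw_def by (cases "v = x") auto
  \<comment> \<open>Arcs that do not lead away from the root, oriented so that \<open>x\<close> is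
    not the head.\<close>
  have half: "(f u, f v) \<in> lollipop_arcs n \<union> (lollipop_arcs n)\<inverse>"
    if uv: "(u, v) \<in> R" "rel_dist R r v \<le> rel_dist R r u" "v \<noteq> x" for u v
  proof -
    have V: "u \<in> V" "v \<in> V" "u \<noteq> v" using arcD[OF uv(1)] by auto
    have lu: "rel_dist R r u \<le> n - 2" "rel_dist R r v \<le> n - 2" using V le by auto
    have step: "rel_dist R r u \<le> Suc (rel_dist R r v)" using rel_dist_arc_le[OF rx(1), of v u] arcD[OF uv(1)] by blast
    show ?thesis
    proof (cases "u = x")
      case True
      \<comment> \<open>\<open>v\<close> is on the last level or on the one before it.\<close>
      then have "f u = 0" "f v = 1 \<or> f v = 2" using uv lu step rx(4) n by (auto simp: f_def)
      then show ?thesis by (auto simp: lollipop_arcs_def)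
    next
      case False
      then have "rel_dist R r u \<noteq> rel_dist R r v"
        using b V uv(3) unfolding bij_betw_def by (auto dest: inj_onD)
      then have "rel_dist R r u = Suc (rel_dist R r v)" using uv(2) step by simp
      then have "f v = Suc (f u)" "f u \<ge> 1" "Suc (f u) < n"
        using False uv(3) lu n by (auto simp: f_def)
      then show ?thesis by (auto simp: lollipop_arcs_def)
    qed
  qed
  have "(f u, f v) \<in> lollipop_arcs n \<union> (lollipop_arcs n)\<inverse>" if uv: "(u, v) \<in> R" for u v
  proof (cases "rel_dist R r v \<le> rel_dist R r u \<and> v \<noteq> x")
    case False
    \<comment> \<open>Every other arc is the reverse of one covered by \<open>half\<close>: as
      \<open>x\<close> is on the last level, it can always serve as the tail.\<close>
    have vu: "(v, u) \<in> R" using arcD[OF uv] by simp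
    have "rel_dist R r u \<le> rel_dist R r v" using False le[of u] arcD[OF uv] rx(4) by auto
    moreover have "(f v, f u) \<in> lollipop_arcs n \<union> (lollipop_arcs n)\<inverse>"
    proof (cases "u = x")
      case True
      have "rel_dist R r v \<le> rel_dist R r u" using le[of v] arcD[OF uv] rx(4) True by simp
      moreover have "v \<noteq> x" using True arcD[OF uv] by auto
      ultimately show ?thesis using False by simp
    qed (use half[OF vu] calculation in simp)
    ultimately show ?thesis by blast
  qed (use half[OF uv] in simp)
  then have "map_prod f f ` R \<subseteq> lollipop_arcs n \<union> (lollipop_arcs n)\<inverse>" by auto
  moreover have "card (lollipop_arcs n) \<le> card V"
    using card_lollipop_arcs[of n] n n_def by simp
  ultimately have "map_prod f f ` R = lollipop_arcs n \<union> (lollipop_arcs n)\<inverse>"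
    using arcs_image_eqI[OF f R finite_lollipop_arcs] by blast
  then show ?thesis using f unfolding n_def by blast
qed

text \<open>Vertices are added in the order \<open>0, 1, 2, ...\<close>; the distances from each one
  to its predecessors sum to the increment in \<open>lollipop_value_Suc\<close>.\<close>

lemma wiener_sum_lollipop:
  assumes n: "n \<ge> 3" and G: "connected_graph {0..<n} (lollipop_arcs n \<union> (lollipop_arcs n)\<inverse>)"
  shows "wiener_sum h {0..<n} (lollipop_arcs n \<union> (lollipop_arcs n)\<inverse>) = lollipop_value h n"
proof -
  define R where "R = lollipop_arcs n \<union> (lollipop_arcs n)\<inverse>"
  interpret connected_graph "{0..<n}" R using G R_def by simp
  \<comment> \<open>A potential for bounding distances from below: it rises by at most 1 along an
    arc and gives 0 and 1, the far triangle vertices, the same height.\<close>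
  define p where "p i = (if i = 0 then 1 else i)" for i :: nat
  have p_step: "p j \<le> Suc (p i)" if "(i, j) \<in> R" for i j
    using that by (auto simp: R_def lollipop_arcs_def p_def)
  have "p j \<le> p i + k" if "(i, j) \<in> R ^^ k" for i j k
    using that
  proof (induction k arbitrary: j)
    case (Suc k)
    then obtain l where "(i, l) \<in> R ^^ k" "(l, j) \<in> R" by auto
    then show ?case using Suc.IH p_step by fastforce
  qed auto
  then have ge: "p j \<le> p i + rel_dist R i j" if "i < n" "j < n" for i j
    using rel_dist_relpow[of i j] that by auto
  have walk: "(i, i + k) \<in> R ^^ k" if "1 \<le> i" "i + k < n" for i k
    using that
  proof (induction k)
    case (Suc k)
    then have "(i + k, i + Suc k) \<in> R" by (auto simp: R_def lollipop_arcs_def)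
    then show ?case using Suc by auto
  qed auto
  have d1: "rel_dist R m i = m - i" if "1 \<le> i" "i < m" "m < n" for i m
  proof -
    have "rel_dist R i m \<le> m - i" using walk[of i "m - i"] that by (intro rel_dist_le) auto
    then show ?thesis using ge[of i m] that rel_dist_sym[of i m] by (auto simp: p_def)
  qed
  have d0: "rel_dist R m 0 = m - 1" if "2 \<le> m" "m < n" for m
  proof -
    \<comment> \<open>The arc from 0 to 2 bypasses 1, so 0 is as far from \<open>m\<close> as 1
      is.\<close>
    have "(0, 2) \<in> R" by (auto simp: R_def lollipop_arcs_def)
    moreover have "(2, m) \<in> R ^^ (m - 2)" using walk[of 2 "m - 2"] that by (metis le_add_diff_inverse one_le_numeral)
    ultimately have "(0, m) \<in> R ^^ Suc (m - 2)" by (rule relpow_Suc_I2)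
    then have "rel_dist R 0 m \<le> m - 1" using rel_dist_le[OF \<open>(0, m) \<in> R ^^ Suc (m - 2)\<close>] that by simp
    then show ?thesis using ge[of 0 m] that rel_dist_sym[of 0 m] by (auto simp: p_def)
  qed
  have d10: "rel_dist R 1 0 = 1"
    using n rel_dist_eq_1_iff[of 1 0] by (auto simp: R_def lollipop_arcs_def)
  define \<phi> where "\<phi> e = h (THE d. \<exists>u v. e = {u, v} \<and> d = rel_dist R u v)" for e
  have \<phi>: "\<phi> {u, v} = h (rel_dist R u v)" for u v unfolding \<phi>_def the_rel_dist ..
  \<comment> \<open>\<open>\<phi>\<close> keeps the distances of the whole graph while the vertex
    set varies, so no distances in subgraphs arise.\<close>
  have rem: "sum \<phi> (pairs {0..<Suc m}) = sum \<phi> (pairs {0..<m}) + (\<Sum>u\<in>{0..<m}. h (rel_dist R m u))" for m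
  proof -
    have "{0..<Suc m} - {m} = {0..<m}" by auto
    then show ?thesis using sum_pairs_remove[of "{0..<Suc m}" m \<phi>] \<phi> by simp
  qed
  have row: "(\<Sum>u\<in>{0..<m}. h (rel_dist R m u)) = (\<Sum>j=1..m - 1. h j) + h (m - 1)"
    if "2 \<le> m" "m < n" for m
  proof -
    have "{0..<m} = insert 0 {1..m - 1}" using that by auto
    then have "(\<Sum>u\<in>{0..<m}. h (rel_dist R m u)) = h (m - 1) + (\<Sum>u=1..m - 1. h (rel_dist R m u))"
      using d0[OF that] by simp
    also have "(\<Sum>u=1..m - 1. h (rel_dist R m u)) = (\<Sum>u=1..m - 1. h (m - u))"
      using d1 that by (intro sum.cong) auto
    also have "\<dots> = (\<Sum>j=1..m - 1. h j)"
      by (rule sum.reindex_bij_witness[where i = "\<lambda>j. m - j" and j = "\<lambda>j. m - j"]) auto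
    finally show ?thesis by simp
  qed
  have p2: "sum \<phi> (pairs {0..<2}) = h 1"
  proof -
    have "pairs {0..<Suc 0} = ({} :: nat set set)"
    proof -
      have "card e \<noteq> 2" if "e \<subseteq> {0..<Suc 0}" for e
        using card_mono[OF _ that] by simp
      then show ?thesis by (auto simp: pairs_def)
    qed
    then show ?thesis using rem[of 1] d10 by (simp add: numeral_2_eq_2)
  qed
  have "sum \<phi> (pairs {0..<m}) = lollipop_value h m" if "3 \<le> m" "m \<le> n" for m
    using that
  proof (induction m rule: dec_induct)
    case base
    have "sum \<phi> (pairs {0..<Suc 2}) = 3 * h 1"
      unfolding rem p2 using row[of 2] n by simp
    then show ?case by (simp add: lollipop_value_def eval_nat_numeral)
  next
    case (step m)
    then show ?case using rem[of m] row[of m] lollipop_value_Suc[of m h] by simp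
  qed
  from this[of n] n show ?thesis unfolding wiener_sum_def R_def[symmetric] \<phi>_def by simp
qed

section \<open>The lower bound\<close>

context connected_graph
begin

lemma arcs_off_diagonal: "R \<subseteq> Sigma V (\<lambda>a. V - {a})"
  using arcD by auto

text \<open>Arcs are exactly the ordered pairs at distance 1 and contribute \<open>h 1\<close>
  each.\<close>

lemma wiener_sum_double_split:
  "2 * wiener_sum h V R = real (card R) * h 1 + (\<Sum>(a, b)\<in>Sigma V (\<lambda>a. V - {a}) - R. h (rel_dist R a b))"
proof -
  let ?S = "Sigma V (\<lambda>a. V - {a})"
  have "2 * wiener_sum h V R = (\<Sum>(a, b)\<in>?S. h (rel_dist R a b))"
    unfolding wiener_sum_def by (simp add: sum_pairs_double[OF finite_verts] the_rel_dist)
  also have "\<dots> = (\<Sum>(a, b)\<in>R. h (rel_dist R a b)) + (\<Sum>(a, b)\<in>?S - R. h (rel_dist R a b))"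
    using sum.subset_diff[OF arcs_off_diagonal, of "\<lambda>(a, b). h (rel_dist R a b)"] finite_verts by simp
  also have "(\<Sum>(a, b)\<in>R. h (rel_dist R a b)) = (\<Sum>(a, b)\<in>R. h 1)"
  proof (rule sum.cong[OF refl], clarify)
    fix a b assume "(a, b) \<in> R"
    then have "rel_dist R a b = 1" using arcD rel_dist_eq_1_iff by blast
    then show "h (rel_dist R a b) = h 1" by simp
  qed
  finally show ?thesis by simp
qed

text \<open>Of the \<open>card V * (card V - 1)\<close> ordered pairs, \<open>2 * card V\<close> are
  arcs.\<close>

lemma card_non_arcs:
  assumes "card R = 2 * card V" "card V \<ge> 3"
  shows "real (card (Sigma V (\<lambda>a. V - {a}) - R)) = real (card V) * (real (card V) - 3)"
proof -
  have "card (Sigma V (\<lambda>a. V - {a}) - R) = card (Sigma V (\<lambda>a. V - {a})) - card R"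
    by (rule card_Diff_subset[OF finite_arcs arcs_off_diagonal])
  also have "card (Sigma V (\<lambda>a. V - {a})) = card V * (card V - 1)"
    using finite_verts by (subst card_SigmaI) auto
  also have "card V * (card V - 1) - card R = card V * (card V - 3)"
    using assms by (simp add: diff_mult_distrib2)
  finally show ?thesis using assms(2) by (simp add: of_nat_diff)
qed

lemma rel_dist_ge_2:
  assumes "(a, b) \<in> Sigma V (\<lambda>a. V - {a}) - R"
  shows "2 \<le> rel_dist R a b"
proof -
  have "a \<in> V" "b \<in> V" "a \<noteq> b" "(a, b) \<notin> R" using assms by auto
  then have "1 \<le> rel_dist R a b" "rel_dist R a b \<noteq> 1" using rel_dist_pos rel_dist_eq_1_iff by blast+
  then show ?thesis by simp
qed

text \<open>Twice the excess over the bound is the sum of \<open>h d - h 2\<close> over the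
  non-adjacent ordered pairs, where \<open>d \<ge> 2\<close>; by strict monotonicity a term vanishes
  only for \<open>d = 2\<close>.\<close>

lemma wiener_sum_ge_diameter_2:
  assumes h: "strict_mono_on {1..} h" and R: "card R = 2 * card V" "card V \<ge> 3"
  shows "real (card V) * h 1 + 1 / 2 * real (card V) * (real (card V) - 3) * h 2 \<le> wiener_sum h V R"
    and "wiener_sum h V R = real (card V) * h 1 + 1 / 2 * real (card V) * (real (card V) - 3) * h 2 \<longleftrightarrow>
      (\<forall>(a, b)\<in>Sigma V (\<lambda>a. V - {a}) - R. rel_dist R a b = 2)"
proof -
  let ?S = "Sigma V (\<lambda>a. V - {a}) - R"
  let ?L = "real (card V) * h 1 + 1 / 2 * real (card V) * (real (card V) - 3) * h 2"
  have fS: "finite ?S" using finite_verts by auto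
  have diff: "2 * (wiener_sum h V R - ?L) = (\<Sum>(a, b)\<in>?S. h (rel_dist R a b) - h 2)"
  proof -
    have "(\<Sum>(a, b)\<in>?S. h (rel_dist R a b) - h 2) = (\<Sum>(a, b)\<in>?S. h (rel_dist R a b)) - real (card ?S) * h 2"
      by (simp add: case_prod_unfold sum_subtractf)
    then show ?thesis
      unfolding right_diff_distrib wiener_sum_double_split card_non_arcs[OF R] R(1) by simp
  qed
  have nonneg: "0 \<le> (case p of (a, b) \<Rightarrow> h (rel_dist R a b) - h 2)" if "p \<in> ?S" for p
  proof -
    obtain a b where p: "p = (a, b)" by (cases p)
    have "2 \<le> rel_dist R a b" using rel_dist_ge_2 that unfolding p by blast
    then show ?thesis using strict_mono_on_leD[OF h, of 2 "rel_dist R a b"] p by simp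
  qed
  have "0 \<le> (\<Sum>(a, b)\<in>?S. h (rel_dist R a b) - h 2)"
    by (rule sum_nonneg) (rule nonneg)
  then show "?L \<le> wiener_sum h V R" using diff by simp
  have "wiener_sum h V R = ?L \<longleftrightarrow> (\<Sum>(a, b)\<in>?S. h (rel_dist R a b) - h 2) = 0"
    using diff by auto
  also have "\<dots> \<longleftrightarrow> (\<forall>(a, b)\<in>?S. h (rel_dist R a b) - h 2 = 0)"
    using sum_nonneg_eq_0_iff[OF fS, of "\<lambda>(a, b). h (rel_dist R a b) - h 2", OF nonneg]
    by (simp only: case_prod_unfold)
  also have "\<dots> \<longleftrightarrow> (\<forall>(a, b)\<in>?S. rel_dist R a b = 2)"
  proof -
    have "h (rel_dist R a b) - h 2 = 0 \<longleftrightarrow> rel_dist R a b = 2" if "(a, b) \<in> ?S" for a b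
    proof (cases "rel_dist R a b = 2")
      case False
      then have "h 2 < h (rel_dist R a b)" using rel_dist_ge_2[OF that] by (intro strict_mono_onD[OF h]) auto
      then show ?thesis using False by simp
    qed simp
    then show ?thesis by blast
  qed
  finally show "wiener_sum h V R = ?L \<longleftrightarrow> (\<forall>(a, b)\<in>?S. rel_dist R a b = 2)" .
qed

lemma sum_degrees: "(\<Sum>v\<in>V. card (R `` {v})) = card R"
proof -
  have "R = Sigma V (\<lambda>v. R `` {v})" using arcD by auto
  then show ?thesis using finite_verts finite_arcs card_SigmaI[of V "\<lambda>v. R `` {v}"]
    by (metis finite_Image)
qed

text \<open>Degrees sum to \<open>2 * card V\<close>, so if none is below 2, all are 2, and diameter
  2 then allows only 5 vertices. Otherwise the neighbour of a leaf lies between the leaf and every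
  other vertex.\<close>

lemma diameter_2_center:
  assumes R: "card R = 2 * card V" and n: "card V \<ge> 6"
    and diam: "\<And>a b. a \<in> V \<Longrightarrow> b \<in> V \<Longrightarrow> rel_dist R a b \<le> 2"
  obtains u where "u \<in> V" "R `` {u} = V - {u}"
proof -
  have via: "\<exists>z. (v, z) \<in> R \<and> (z, w) \<in> R" if vw: "v \<in> V" "w \<in> V" "w \<noteq> v" "(v, w) \<notin> R" for v w
  proof -
    have "2 \<le> rel_dist R v w" using rel_dist_ge_2 vw by auto
    then have "rel_dist R v w = Suc 1" using diam[of v w] vw by simp
    then obtain z where "z \<in> V" "(z, w) \<in> R" "rel_dist R v z = 1" using rel_dist_pred[OF vw(1,2)] by blast
    then show ?thesis using rel_dist_eq_1_iff[OF vw(1)] by blast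
  qed
  have fN: "finite (R `` {v})" for v using finite_arcs by (simp add: finite_Image)
  have "\<exists>v\<in>V. card (R `` {v}) \<le> 1"
  proof (rule ccontr)
    assume "\<not> ?thesis"
    then have ge: "2 \<le> card (R `` {v})" if "v \<in> V" for v using that by fastforce
    \<comment> \<open>Truncated subtraction is exact here, as all degrees are at least 2.\<close>
    have "(\<Sum>v\<in>V. card (R `` {v}) - 2) = 0"
      using sum_degrees R sum_subtractf_nat[of V "\<lambda>_. 2" "\<lambda>v. card (R `` {v})"] ge by simp
    then have "card (R `` {v}) - 2 = 0" if "v \<in> V" for v
      using that finite_verts by simp
    then have deg: "card (R `` {v}) = 2" if "v \<in> V" for v using ge that by fastforce
    obtain v where v: "v \<in> V" using n by fastforce
    \<comment> \<open>\<open>v\<close>, its two neighbours, and one further neighbour of each of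
      these: at most 5 vertices.\<close>
    have "V \<subseteq> insert v (R `` {v} \<union> (\<Union>z\<in>R `` {v}. R `` {z} - {v}))" (is "_ \<subseteq> insert v (?A \<union> ?B)")
      using via[OF v] by blast
    then have "card V \<le> card (insert v (?A \<union> ?B))"
      using fN by (intro card_mono) auto
    also have "\<dots> \<le> Suc (card (?A \<union> ?B))" using fN by (simp add: card_insert_if)
    also have "card (?A \<union> ?B) \<le> card ?A + card ?B" by (rule card_Un_le)
    also have "card ?B \<le> (\<Sum>z\<in>?A. card (R `` {z} - {v}))" using fN by (rule card_UN_le)
    also have "\<dots> = (\<Sum>z\<in>?A. 1)"
    proof (rule sum.cong[OF refl])
      fix z assume "z \<in> ?A"
      then have "v \<in> R `` {z}" "z \<in> V" using arcD[of v z] by auto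
      then show "card (R `` {z} - {v}) = 1" using deg fN by simp
    qed
    finally show False using deg[OF v] n by simp
  qed
  then obtain v where v: "v \<in> V" "card (R `` {v}) \<le> 1" by blast
  have "V - {v} \<noteq> {}"
  proof
    assume "V - {v} = {}"
    then have "card V \<le> card {v}" by (intro card_mono) auto
    then show False using n by simp
  qed
  then obtain w where "w \<in> V" "w \<noteq> v" by auto
  then obtain u where u: "(v, u) \<in> R" using via[OF v(1)] by blast
  have only: "z = u" if "(v, z) \<in> R" for z
    using that u v(2) card_le_Suc0_iff_eq[OF fN, of v] by auto
  have "R `` {u} = V - {u}"
  proof (intro equalityI subsetI)
    fix w assume w: "w \<in> V - {u}"
    show "w \<in> R `` {u}"
    proof (cases "w = v")
      case True
      then show ?thesis using arcD[OF u] by simp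
    next
      case False
      then show ?thesis using via[OF v(1), of w] only w by blast
    qed
  qed (use arcD in auto)
  then show thesis using that arcD[OF u] by blast
qed

text \<open>The center lies on \<open>card V - 1\<close> of the \<open>card V\<close> edges, so
  exactly one edge avoids it, and this edge completes the triangle.\<close>

lemma center_iso:
  assumes R: "card R = 2 * card V" and n: "card V \<ge> 3" and u: "u \<in> V" "R `` {u} = V - {u}"
  shows "\<exists>f. bij_betw f V {0..<card V} \<and>
    map_prod f f ` R = triangle_star_arcs (card V) \<union> (triangle_star_arcs (card V))\<inverse>"
proof -
  define n where "n = card V"
  have "card (V - {u}) = n - 1" using u n_def by simp
  then have "card (del_vertex u R) = 2" using card_del_vertex[OF u(1)] R u(2) n n_def by simp
  then obtain s t where st: "del_vertex u R = {s, t}" "s \<noteq> t" by (meson card_2_iff)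
  obtain a b where ab: "s = (a, b)" by (cases s)
  then have D: "(a, b) \<in> R" "a \<noteq> u" "b \<noteq> u" using st by (auto simp: del_vertex_def)
  then have V: "a \<in> V" "b \<in> V" "a \<noteq> b" "(b, a) \<in> del_vertex u R" using arcD[OF D(1)] by (auto simp: del_vertex_def)
  then have arcs: "del_vertex u R = {(a, b), (b, a)}" using st ab by auto
  have "card (V - {u, a, b}) = card {3..<n}"
    using V D u by (subst card_Diff_subset) (auto simp: n_def)
  \<comment> \<open>The other vertices are leaves at the center, so any numbering of them will
    do.\<close>
  then obtain g where g: "bij_betw g (V - {u, a, b}) {3..<n}"
    using finite_same_card_bij[of "V - {u, a, b}" "{3..<n}"] finite_verts by auto
  define f where "f = g(a := 0, b := 1, u := 2)"
  have vals: "f a = 0" "f b = 1" "f u = 2" using V D by (auto simp: f_def)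
  have fg: "f v = g v" if "v \<notin> {u, a, b}" for v using that by (simp add: f_def)
  have f1: "bij_betw f (V - {u, a, b}) {3..<n}"
    using g by (rule bij_betw_cong[THEN iffD1, rotated]) (simp add: fg)
  have f2: "bij_betw f {u, a, b} {0, 1, 2}" using vals V D by (auto simp: bij_betw_def)
  have "bij_betw f ((V - {u, a, b}) \<union> {u, a, b}) ({3..<n} \<union> {0, 1, 2})"
    by (rule bij_betw_combine[OF f1 f2]) auto
  moreover have "(V - {u, a, b}) \<union> {u, a, b} = V" using V u by auto
  moreover have "{3..<n} \<union> {0, 1, 2} = {0..<n}" using n n_def by auto
  ultimately have f: "bij_betw f V {0..<n}" by simp
  let ?A = "triangle_star_arcs n"
  have star: "(2, f w) \<in> ?A \<union> ?A\<inverse>" if "w \<in> V" "w \<noteq> u" for w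
  proof (cases "w \<in> {a, b}")
    case True
    then show ?thesis using vals by (auto simp: triangle_star_arcs_def)
  next
    case False
    then have "f w \<in> {3..<n}" using f1 that by (auto simp: bij_betw_def)
    then show ?thesis by (auto simp: triangle_star_arcs_def)
  qed
  have "(f v, f w) \<in> ?A \<union> ?A\<inverse>" if vw: "(v, w) \<in> R" for v w
  proof (cases "v = u \<or> w = u")
    case True
    then show ?thesis using star[of v] star[of w] arcD[OF vw] vals by auto
  next
    case False
    then have "(v, w) \<in> del_vertex u R" using vw by (simp add: del_vertex_def)
    then show ?thesis using arcs vals by (auto simp: triangle_star_arcs_def)
  qed
  then have "map_prod f f ` R \<subseteq> ?A \<union> ?A\<inverse>" by auto
  moreover have "card ?A \<le> card V"
    using card_triangle_star_arcs[of n] n n_def by simp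
  ultimately have "map_prod f f ` R = ?A \<union> ?A\<inverse>"
    using arcs_image_eqI[OF f _ finite_triangle_star_arcs] R by simp
  then show ?thesis using f n_def by blast
qed

lemma wiener_sum_eq_diameter_2_iff:
  assumes h: "strict_mono_on {1..} h" and R: "card R = 2 * card V" and n: "card V \<ge> 6"
  shows "wiener_sum h V R = real (card V) * h 1 + 1 / 2 * real (card V) * (real (card V) - 3) * h 2 \<longleftrightarrow>
    (\<exists>f. bij_betw f V {0..<card V} \<and>
      map_prod f f ` R = triangle_star_arcs (card V) \<union> (triangle_star_arcs (card V))\<inverse>)" (is "_ = ?L \<longleftrightarrow> ?iso")
proof
  have n3: "card V \<ge> 3" using n by simp
  note iff = wiener_sum_ge_diameter_2(2)[OF h R n3]
  {
    assume "wiener_sum h V R = ?L"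
    with iff have d: "\<forall>(a, b)\<in>Sigma V (\<lambda>a. V - {a}) - R. rel_dist R a b = 2" by blast
    have "rel_dist R a b \<le> 2" if "a \<in> V" "b \<in> V" for a b
    proof (cases "a = b \<or> (a, b) \<in> R")
      case True
      then show ?thesis using rel_dist_eq_1_iff[OF that] by auto
    next
      case False
      then have "(a, b) \<in> Sigma V (\<lambda>a. V - {a}) - R" using that by auto
      from bspec[OF d this] show ?thesis by simp
    qed
    then obtain u where "u \<in> V" "R `` {u} = V - {u}" using diameter_2_center[OF R n] by blast
    then show ?iso using center_iso[OF R n3] by blast
  next
    assume ?iso
    then obtain f where f: "bij_betw f V {0..<card V}"
      and fR: "map_prod f f ` R = triangle_star_arcs (card V) \<union> (triangle_star_arcs (card V))\<inverse>" by blast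
    \<comment> \<open>The vertex labelled 2 is adjacent to all others, so non-adjacent vertices have
      distance 2 through it.\<close>
    have "2 \<in> f ` V" using f n unfolding bij_betw_def by simp
    then obtain c where c: "c \<in> V" "f c = 2" by auto
    have arc: "(c, v) \<in> R" if v: "v \<in> V" "v \<noteq> c" for v
    proof -
      have "f v < card V" "f v \<noteq> 2"
        using f v c inj_on_eq_iff[of f V v c] unfolding bij_betw_def by auto
      then have "f v = 0 \<or> f v = 1 \<or> f v \<in> {3..<card V}" by auto
      then have "(f c, f v) \<in> map_prod f f ` R"
        unfolding fR c(2) by (auto simp: triangle_star_arcs_def)
      then obtain x y where "(x, y) \<in> R" "f c = f x" "f v = f y" by auto
      moreover then have "x \<in> V" "y \<in> V" using arcD by blast+
      ultimately show ?thesis using f c v unfolding bij_betw_def by (metis inj_onD)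
    qed
    have "rel_dist R a b = 2" if "(a, b) \<in> Sigma V (\<lambda>a. V - {a}) - R" for a b
    proof -
      have "a \<noteq> c" "b \<noteq> c" using that arc arcD by blast+
      then have "(a, c) \<in> R" "(c, b) \<in> R" using that arc arcD by blast+
      then have "(a, b) \<in> R ^^ 2" by (auto simp: numeral_2_eq_2)
      then show ?thesis using rel_dist_le rel_dist_ge_2[OF that] by (metis order_antisym)
    qed
    then show "wiener_sum h V R = ?L" using iff by blast
  }
qed

end

section \<open>Unicyclic graphs\<close>

context connected_graph
begin

text \<open>At the root no vertex qualifies and the choice is unspecified.\<close>

definition parent :: "'a \<Rightarrow> 'a \<Rightarrow> 'a" where
  "parent r v = (SOME w. (w, v) \<in> R \<and> Suc (rel_dist R r w) = rel_dist R r v)"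

definition tree_arcs :: "'a \<Rightarrow> 'a rel" where
  "tree_arcs r = (\<lambda>v. (parent r v, v)) ` (V - {r}) \<union> (\<lambda>v. (v, parent r v)) ` (V - {r})"

lemma parent:
  assumes "r \<in> V" "v \<in> V - {r}"
  shows "(parent r v, v) \<in> R" "Suc (rel_dist R r (parent r v)) = rel_dist R r v"
proof -
  obtain k where "rel_dist R r v = Suc k" using rel_dist_pos[of r v] assms by (cases "rel_dist R r v") auto
  moreover then obtain w where "(w, v) \<in> R" "rel_dist R r w = k" using rel_dist_pred assms by blast
  ultimately have "\<exists>w. (w, v) \<in> R \<and> Suc (rel_dist R r w) = rel_dist R r v" by auto
  from someI_ex[OF this]
  show "(parent r v, v) \<in> R" "Suc (rel_dist R r (parent r v)) = rel_dist R r v"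
    unfolding parent_def by auto
qed

lemma tree_arcs_subset: "r \<in> V \<Longrightarrow> tree_arcs r \<subseteq> R"
  using parent arcD unfolding tree_arcs_def by blast

lemma sym_tree_arcs: "sym (tree_arcs r)"
  by (auto simp: tree_arcs_def sym_def)

lemma tree_arc_parent:
  assumes r: "r \<in> V" and ab: "(a, b) \<in> tree_arcs r" and le: "rel_dist R r a \<le> rel_dist R r b"
  shows "a = parent r b"
proof -
  consider "b \<in> V - {r}" "a = parent r b" | "a \<in> V - {r}" "b = parent r a"
    using ab by (auto simp: tree_arcs_def)
  then show ?thesis
  proof cases
    case 2
    then show ?thesis using parent(2)[OF r, of a] le by simp
  qed
qed

text \<open>Comparing levels shows that no two vertices are parents of each other, so the two
  orientations are disjoint.\<close>

lemma card_tree_arcs: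
  assumes r: "r \<in> V"
  shows "card (tree_arcs r) = 2 * (card V - 1)"
proof -
  let ?A = "(\<lambda>v. (parent r v, v)) ` (V - {r})" and ?B = "(\<lambda>v. (v, parent r v)) ` (V - {r})"
  have "x \<notin> ?B" if "x \<in> ?A" for x
  proof
    assume "x \<in> ?B"
    then obtain v where v: "v \<in> V - {r}" "x = (v, parent r v)" by blast
    from that obtain u where u: "u \<in> V - {r}" "x = (parent r u, u)" by blast
    have "v = parent r u" "u = parent r v" using u(2) v(2) by auto
    then have "Suc (rel_dist R r v) = rel_dist R r u" "Suc (rel_dist R r u) = rel_dist R r v"
      using parent(2)[OF r u(1)] parent(2)[OF r v(1)] by metis+
    then show False by linarith
  qed
  then have "?A \<inter> ?B = {}" by blast
  then have "card (tree_arcs r) = card ?A + card ?B"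
    unfolding tree_arcs_def using finite_verts by (intro card_Un_disjoint) auto
  moreover have "card ?A = card (V - {r})" "card ?B = card (V - {r})"
    by (auto intro!: card_image simp: inj_on_def)
  ultimately show ?thesis using r finite_verts by simp
qed

lemma tree_reachable:
  assumes r: "r \<in> V" and "u \<in> V" "v \<in> V"
  shows "(u, v) \<in> (tree_arcs r)\<^sup>*"
proof -
  have root: "(r, v) \<in> (tree_arcs r)\<^sup>*" if "v \<in> V" for v
    using that
  proof (induction "rel_dist R r v" arbitrary: v)
    case 0
    then show ?case using rel_dist_eq_0_iff[OF r] by auto
  next
    case (Suc k)
    then have v: "v \<in> V - {r}" by auto
    have "(parent r v, v) \<in> tree_arcs r" using v by (auto simp: tree_arcs_def)
    moreover have "(r, parent r v) \<in> (tree_arcs r)\<^sup>*"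
      using Suc.hyps parent[OF r v] arcD by (metis Suc_inject)
    ultimately show ?case by (meson rtrancl.rtrancl_into_rtrancl)
  qed
  then show ?thesis using assms sym_rtrancl[OF sym_tree_arcs, of r] by (meson rtrancl_trans symD)
qed

text \<open>At a vertex of maximal level both neighbours on the cycle would be its parent.\<close>

lemma no_tree_cycle:
  assumes r: "r \<in> V" and p: "set p \<subseteq> tree_arcs r" "3 \<le> length p" "distinct (map snd p)"
    and closed: "\<And>i. i < length p \<Longrightarrow> fst (p ! (Suc i mod length p)) = snd (p ! i)"
  shows False
proof -
  define k where "k = length p"
  have k: "k \<ge> 3" using p k_def by simp
  define d where "d i = rel_dist R r (snd (p ! i))" for i
  have "0 \<in> {..<k}" using k by simp
  then have fin: "finite (d ` {..<k})" "d ` {..<k} \<noteq> {}" by blast+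
  from Max_in[OF fin] obtain m where "m < k" "Max (d ` {..<k}) = d m" by blast
  then have m: "m < k" "\<And>i. i < k \<Longrightarrow> d i \<le> d m" using Max_ge[OF fin(1)] by auto
  \<comment> \<open>The index cyclically before \<open>m\<close>; \<open>m'\<close> is the one after
    it.\<close>
  define l where "l = (if m = 0 then k - 1 else m - 1)"
  define m' where "m' = Suc m mod k"
  have l: "l < k" "Suc l mod k = m" using m(1) k by (auto simp: l_def)
  have m': "m' < k" using k by (simp add: m'_def)
  have inT: "p ! i \<in> tree_arcs r" if "i < k" for i using p(1) that k_def by auto
  have "fst (p ! m) = snd (p ! l)" using closed[of l] l unfolding k_def by simp
  moreover have "(fst (p ! m), snd (p ! m)) \<in> tree_arcs r" using inT[OF m(1)] by simp
  ultimately have 1: "snd (p ! l) = parent r (snd (p ! m))"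
    using tree_arc_parent[OF r] m(2)[OF l(1)] by (simp add: d_def)
  have "fst (p ! m') = snd (p ! m)" using closed[of m] m(1) unfolding k_def m'_def by simp
  moreover have "(snd (p ! m'), fst (p ! m')) \<in> tree_arcs r"
    using inT[OF m'] sym_tree_arcs by (metis prod.collapse symD)
  ultimately have 2: "snd (p ! m') = parent r (snd (p ! m))"
    using tree_arc_parent[OF r] m(2)[OF m'] by (simp add: d_def)
  \<comment> \<open>As the heads are distinct, both cyclic neighbours of \<open>m\<close> coincide,
    which is impossible for \<open>k \<ge> 3\<close>.\<close>
  have "l = m'" using 1 2 nth_eq_iff_index_eq[OF p(3), of l m'] l(1) m' by (simp add: k_def)
  then show False using m(1) k by (auto simp: l_def m'_def mod_if split: if_splits)
qed

end

section \<open>Arc walks, relation powers and cycles\<close>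

context pair_graph
begin

lemma parcs_sym: "(a, b) \<in> parcs G \<Longrightarrow> (b, a) \<in> parcs G"
  using pair_sym_arcs by (auto simp: symmetric_def dest: symD)

lemma connected_graphI:
  assumes "Digraph_Component.connected (with_proj G)"
  shows "connected_graph (pverts G) (parcs G)"
proof
  have sc: "strongly_connected (with_proj G)"
    using symmetric_connected_imp_strongly_connected[OF pair_sym_arcs assms] .
  show "(u, v) \<in> (parcs G)\<^sup>*" if "u \<in> pverts G" "v \<in> pverts G" for u v
    using sc that rtrancl_on_rtranclI[of u v "pverts G" "parcs G"]
    by (simp add: strongly_connected_def reachable_def)
  show "(x, x) \<notin> parcs G" for x using no_loops' by blast
qed (use pair_finite_verts wellformed' parcs_sym in \<open>auto simp: sym_def\<close>)

text \<open>The subrelation \<open>S\<close> is the whole arc set when distances are compared and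
  the tree when cycles are closed.\<close>

lemma relpow_awalk:
  assumes S: "S \<subseteq> parcs G" and u: "u \<in> pverts G" and "(u, v) \<in> S ^^ k"
  shows "\<exists>p. awalk u p v \<and> length p = k \<and> set p \<subseteq> S"
  using assms(3)
proof (induction k arbitrary: v)
  case 0
  then show ?case using u by (auto simp: awalk_Nil_iff)
next
  case (Suc k)
  then obtain w where w: "(u, w) \<in> S ^^ k" "(w, v) \<in> S" by auto
  then obtain p where p: "awalk u p w" "length p = k" "set p \<subseteq> S" using Suc.IH by blast
  have "awalk w [(w, v)] v" using w(2) S wellformed' by (auto simp: awalk_def)
  then have "awalk u (p @ [(w, v)]) v" by (rule awalk_appendI[OF p(1)])
  then show ?case using p w(2) by (intro exI[of _ "p @ [(w, v)]"]) auto
qed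

text \<open>A path has distinct arcs, so inclusion of the arc sets already bounds its
  length.\<close>

lemma awalk_shorten:
  assumes "awalk u p v"
  shows "\<exists>q. apath u q v \<and> length q \<le> length p \<and> set q \<subseteq> set p"
proof (intro exI conjI)
  let ?q = "awalk_to_apath p"
  show q: "apath u ?q v" by (rule apath_awalk_to_apath[OF assms])
  show sub: "set ?q \<subseteq> set p" by (rule awalk_to_apath_subset[OF assms])
  have "distinct ?q" using q distinct_verts_imp_distinct unfolding apath_def by blast
  then have "length ?q = card (set ?q)" by (simp add: distinct_card)
  also have "\<dots> \<le> card (set p)" using sub by (intro card_mono) auto
  also have "\<dots> \<le> length p" by (rule card_length)
  finally show "length ?q \<le> length p" .
qed

lemma awalk_relpow: "awalk u p v \<Longrightarrow> (u, v) \<in> parcs G ^^ length p"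
proof (induction p arbitrary: u)
  case (Cons a p)
  then have "a \<in> parcs G" "fst a = u" "awalk (snd a) p v" by (auto simp: awalk_Cons_iff)
  then have "(u, snd a) \<in> parcs G" "(snd a, v) \<in> parcs G ^^ length p" using Cons.IH by (metis prod.collapse)+
  then show ?case using relpow_Suc_I2[of u "snd a" "parcs G" v "length p"] by simp
qed (auto simp: awalk_Nil_iff)

text \<open>Walks shorten to paths, so both minima agree.\<close>

lemma graph_dist_eq_rel_dist:
  assumes con: "Digraph_Component.connected (with_proj G)" and uv: "u \<in> pverts G" "v \<in> pverts G"
  shows "graph_dist G u v = rel_dist (parcs G) u v"
  unfolding graph_dist_def
proof (rule Least_equality)
  interpret C: connected_graph "pverts G" "parcs G" by (rule connected_graphI[OF con])
  obtain p where "awalk u p v" "length p = rel_dist (parcs G) u v"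
    using relpow_awalk[OF _ uv(1) C.rel_dist_relpow[OF uv]] by auto
  then obtain q where q: "apath u q v" "length q \<le> rel_dist (parcs G) u v" using awalk_shorten by metis
  moreover then have "rel_dist (parcs G) u v \<le> length q"
    using awalk_relpow rel_dist_le unfolding apath_def by metis
  ultimately show "\<exists>q. apath u q v \<and> length q = rel_dist (parcs G) u v" by auto
next
  fix k assume "\<exists>p. apath u p v \<and> length p = k"
  then show "rel_dist (parcs G) u v \<le> k" using awalk_relpow rel_dist_le unfolding apath_def by metis
qed

lemma wiener_index_eq_wiener_sum:
  assumes con: "Digraph_Component.connected (with_proj G)"
  shows "wiener_index h G = wiener_sum h (pverts G) (parcs G)"
proof -
  interpret C: connected_graph "pverts G" "parcs G" by (rule connected_graphI[OF con])
  show ?thesis unfolding wiener_index_def wiener_sum_def pairs_def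
  proof (rule sum.cong[OF refl], clarify)
    fix e assume e: "e \<subseteq> pverts G" "card e = 2"
    then obtain u v where uv: "e = {u, v}" "u \<in> pverts G" "v \<in> pverts G" by (auto simp: card_2_iff)
    show "h (THE d. \<exists>u v. e = {u, v} \<and> d = graph_dist G u v)
        = h (THE d. \<exists>u v. e = {u, v} \<and> d = rel_dist (parcs G) u v)"
      unfolding uv(1) pair_dist_eq[OF pair_graph] C.the_rel_dist graph_dist_eq_rel_dist[OF con uv(2,3)] ..
  qed
qed

lemma awalk_nth:
  assumes "awalk u p v" "Suc i < length p"
  shows "fst (p ! Suc i) = snd (p ! i)"
  using assms
proof (induction p arbitrary: u i)
  case (Cons a p)
  then show ?case
    by (cases i; cases p) (auto simp: awalk_Cons_iff)
qed simp

text \<open>Translates a cycle into the cyclically indexed arc list of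
  \<open>no_tree_cycle\<close>.\<close>

lemma cycle_has_non_tree_arc:
  assumes con: "Digraph_Component.connected (with_proj G)" and r: "r \<in> pverts G"
    and p: "cycle p" "3 \<le> length p"
  shows "\<not> set p \<subseteq> connected_graph.tree_arcs (pverts G) (parcs G) r"
proof
  interpret C: connected_graph "pverts G" "parcs G" by (rule connected_graphI[OF con])
  assume sub: "set p \<subseteq> C.tree_arcs r"
  obtain u where u: "awalk u p u" "distinct (tl (awalk_verts u p))" "p \<noteq> []"
    using p(1) unfolding cycle_def by auto
  have cas: "pcas u p u" using u(1) by auto
  have "awalk_verts u p = fst (hd p) # map snd p"
    using awalk_verts_conv'[of u p u] cas u(3) by simp
  then have "distinct (map snd p)" using u(2) by simp
  moreover have "fst (p ! (Suc i mod length p)) = snd (p ! i)" if "i < length p" for i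
  proof (cases "Suc i < length p")
    case True
    then show ?thesis using awalk_nth[OF u(1)] by simp
  next
    \<comment> \<open>For the last arc the index wraps around to 0; both arcs meet at the base point
      \<open>u\<close>.\<close>
    case False
    then have i: "Suc i = length p" using that by simp
    then have "p ! i = last p" using u(3) by (metis diff_Suc_1 last_conv_nth)
    moreover have "fst (hd p) = u" using cas u(3) by (cases p) auto
    moreover have "snd (last p) = u"
      using awlast_of_awalk[OF u(1)] u(3) by (simp add: awalk_verts_conv)
    ultimately show ?thesis using i u(3) by (simp add: hd_conv_nth)
  qed
  ultimately show False using C.no_tree_cycle[OF r sub p(2)] by blast
qed

text \<open>The tree path from \<open>y\<close> back to \<open>x\<close> closes the arc.\<close>

lemma fundamental_cycle:
  assumes con: "Digraph_Component.connected (with_proj G)" and r: "r \<in> pverts G"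
    and xy: "(x, y) \<in> parcs G" "(x, y) \<notin> connected_graph.tree_arcs (pverts G) (parcs G) r"
  shows "\<exists>q. cycle ((x, y) # q) \<and> 2 \<le> length q \<and>
    set q \<subseteq> connected_graph.tree_arcs (pverts G) (parcs G) r"
proof -
  interpret C: connected_graph "pverts G" "parcs G" by (rule connected_graphI[OF con])
  have V: "x \<in> pverts G" "y \<in> pverts G" "x \<noteq> y" using C.arcD[OF xy(1)] by auto
  obtain k where "(y, x) \<in> C.tree_arcs r ^^ k"
    using C.tree_reachable[OF r V(2,1)] rtrancl_imp_relpow by blast
  then obtain p where "awalk y p x" "set p \<subseteq> C.tree_arcs r"
    using relpow_awalk[OF C.tree_arcs_subset[OF r] V(2)] by blast
  then obtain q where q: "apath y q x" "set q \<subseteq> C.tree_arcs r" using awalk_shorten by (meson order_trans)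
  then have aw: "awalk y q x" and dis: "distinct (awalk_verts y q)" by (auto simp: apath_def)
  \<comment> \<open>A shorter \<open>q\<close> would mean \<open>x = y\<close> or consist of the arc
    \<open>(y, x)\<close>, which would put \<open>(x, y)\<close> into the tree.\<close>
  have "2 \<le> length q"
  proof (rule ccontr)
    assume "\<not> 2 \<le> length q"
    then consider "q = []" | a where "q = [a]" by (cases q; cases "tl q") auto
    then show False
    proof cases
      case 1
      then show False using aw V(3) by (simp add: awalk_Nil_iff)
    next
      case 2
      then have "a = (y, x)" using aw by (cases a) (auto simp: awalk_Cons_iff awalk_Nil_iff)
      then have "(x, y) \<in> C.tree_arcs r" using q(2) 2 C.sym_tree_arcs by (auto dest: symD)
      then show False using xy(2) by blast
    qed
  qed
  moreover have "awalk x ((x, y) # q) x" using aw xy(1) V by (simp add: awalk_Cons_iff)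
  then have "cycle ((x, y) # q)" unfolding cycle_def using dis by (intro exI[of _ x]) simp
  ultimately show ?thesis using q(2) by blast
qed

text \<open>
  Every arc outside the tree closes a cycle with the tree, and the undirected edge it belongs to
  is the only one of that cycle outside the tree.
\<close>

lemma unicyclic_card_arcs:
  assumes uni: "unicyclic G"
  shows "card (parcs G) = 2 * card (pverts G)"
proof -
  have con: "Digraph_Component.connected (with_proj G)" and ex1: "\<exists>!C. C \<in> cycle_edge_sets G"
    using uni by (auto simp: unicyclic_def)
  interpret C: connected_graph "pverts G" "parcs G" by (rule connected_graphI[OF con])
  let ?E = "\<lambda>a. {fst a, snd a}"
  obtain p where p: "cycle p" "3 \<le> length p" using ex1 unfolding cycle_edge_sets_def by blast
  then have "set p \<subseteq> parcs G" unfolding cycle_def by auto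
  moreover have "hd p \<in> set p" using p(2) by (intro hd_in_set) auto
  ultimately obtain r where r: "r \<in> pverts G" using arc_fst_in_verts by blast
  let ?T = "C.tree_arcs r"
  obtain x y where xy: "(x, y) \<in> parcs G - ?T"
    using cycle_has_non_tree_arc[OF con r p] \<open>set p \<subseteq> parcs G\<close> by auto
  have cyc: "\<exists>q. insert {x, y} (?E ` set q) \<in> cycle_edge_sets G \<and> set q \<subseteq> ?T"
    if xy: "(x, y) \<in> parcs G - ?T" for x y
  proof -
    obtain q where q: "cycle ((x, y) # q)" "2 \<le> length q" "set q \<subseteq> ?T"
      using fundamental_cycle[OF con r, of x y] xy by blast
    then have "?E ` set ((x, y) # q) \<in> cycle_edge_sets G"
      unfolding cycle_edge_sets_def by (intro CollectI exI[of _ "(x, y) # q"]) auto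
    then show ?thesis using q(3) by (intro exI[of _ q]) simp
  qed
  \<comment> \<open>By uniqueness, both arcs close cycles with the same edge set, whose only edge
    outside the tree is that of \<open>(x, y)\<close>.\<close>
  have only: "(z, w) = (x, y) \<or> (z, w) = (y, x)" if zw: "(z, w) \<in> parcs G - ?T" for z w
  proof -
    obtain q where q: "insert {x, y} (?E ` set q) \<in> cycle_edge_sets G" "set q \<subseteq> ?T"
      using cyc[OF xy] by blast
    obtain q' where q': "insert {z, w} (?E ` set q') \<in> cycle_edge_sets G"
      using cyc[OF zw] by blast
    have "{z, w} \<in> insert {x, y} (?E ` set q)" using q q' ex1 by (metis insertI1)
    moreover have "{z, w} \<notin> ?E ` set q"
    proof
      assume "{z, w} \<in> ?E ` set q"
      then obtain b where "b \<in> ?T" "{z, w} = {fst b, snd b}" using q(2) by auto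
      then have "(z, w) \<in> ?T" using C.sym_tree_arcs
        by (cases b) (auto simp: doubleton_eq_iff dest: symD)
      then show False using zw by blast
    qed
    ultimately show ?thesis by (auto simp: doubleton_eq_iff)
  qed
  have "(y, x) \<in> parcs G - ?T" using xy parcs_sym C.sym_tree_arcs by (auto dest: symD)
  then have "parcs G - ?T = {(x, y), (y, x)}" using xy only by fast
  moreover have "x \<noteq> y" using xy C.arcD by blast
  ultimately have "card (parcs G - ?T) = 2" by simp
  then have "card (parcs G) = card ?T + 2"
    using card_Diff_subset[OF finite_subset[OF C.tree_arcs_subset[OF r] pair_finite_arcs] C.tree_arcs_subset[OF r]]
      card_mono[OF pair_finite_arcs C.tree_arcs_subset[OF r]] by simp
  moreover have "card (pverts G) > 0" using r pair_finite_verts by (auto simp: card_gt_0_iff)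
  ultimately show ?thesis using C.card_tree_arcs[OF r] by simp
qed

end

section \<open>Wiener indices of unicyclic graphs\<close>

text \<open>Arcs are pairs with \<open>fst\<close> and \<open>snd\<close> as tail and head, so the
  vertex map determines the arc map of an isomorphism.\<close>

lemma (in pair_graph) graph_iso_iff:
  "G \<cong>\<^sub>g H \<longleftrightarrow> (\<exists>f. bij_betw f (pverts G) (pverts H) \<and> map_prod f f ` parcs G = parcs H)"
proof
  assume "G \<cong>\<^sub>g H"
  then obtain f where f: "digraph_isomorphism f" and H: "with_proj H = app_iso f (with_proj G)"
    unfolding graph_iso_def digraph_iso_def by blast
  have sel: "pverts H = iso_verts f ` pverts G" "parcs H = iso_arcs f ` parcs G"
    "iso_tail f = fst" "iso_head f = snd"
    using arg_cong[OF H, of verts] arg_cong[OF H, of arcs] arg_cong[OF H, of tail] arg_cong[OF H, of head]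
    by simp_all
  have "iso_arcs f a = map_prod (iso_verts f) (iso_verts f) a" if "a \<in> parcs G" for a
    using iso_verts_tail[OF f] iso_verts_head[OF f] that unfolding sel(3,4)
    by (auto simp: prod_eq_iff)
  then have "map_prod (iso_verts f) (iso_verts f) ` parcs G = parcs H"
    unfolding sel(2) by (intro image_cong) auto
  moreover have "bij_betw (iso_verts f) (pverts G) (pverts H)"
    using digraph_isomorphism_inj_on_verts[OF f] sel(1) by (simp add: bij_betw_def)
  ultimately show "\<exists>f. bij_betw f (pverts G) (pverts H) \<and> map_prod f f ` parcs G = parcs H" by blast
next
  assume "\<exists>f. bij_betw f (pverts G) (pverts H) \<and> map_prod f f ` parcs G = parcs H"
  then obtain f where f: "bij_betw f (pverts G) (pverts H)" "map_prod f f ` parcs G = parcs H" by blast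
  let ?f = "\<lparr>iso_verts = f, iso_arcs = map_prod f f, iso_head = snd, iso_tail = fst\<rparr>"
  have inj: "inj_on f (pverts G)" using f(1) by (simp add: bij_betw_def)
  have "parcs G \<subseteq> pverts G \<times> pverts G" using wellformed' by auto
  then have "inj_on (map_prod f f) (parcs G)" using map_prod_inj_on[OF inj inj] inj_on_subset by blast
  then have "digraph_isomorphism ?f"
    unfolding digraph_isomorphism_def using inj by (simp add: wf_digraph_axioms)
  moreover have "with_proj H = app_iso ?f (with_proj G)"
    using f by (simp add: app_iso_def with_proj_def bij_betw_def)
  ultimately show "G \<cong>\<^sub>g H" unfolding graph_iso_def digraph_iso_def by blast
qed

lemma G3_graph_eq:
  assumes "3 \<le> n"
  shows "pverts (G3_graph n) = {0..<n}" "parcs (G3_graph n) = lollipop_arcs n \<union> (lollipop_arcs n)\<inverse>"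
proof -
  show "pverts (G3_graph n) = {0..<n}"
    using assms by (auto simp: G3_graph_def graph_union_def triangle_def path_from_2_def undirected_def)
  \<comment> \<open>The triangle arc \<open>(1, 2)\<close> is the first successor arc.\<close>
  have "{1..<n - 1} = insert 1 {i. 2 \<le> i \<and> Suc i < n}" using assms by auto
  then have "lollipop_arcs n = {(0, 1), (0, 2), (1, 2)} \<union> {(i, Suc i) | i. 2 \<le> i \<and> Suc i < n}"
    by (auto simp: lollipop_arcs_def)
  then show "parcs (G3_graph n) = lollipop_arcs n \<union> (lollipop_arcs n)\<inverse>"
    by (auto simp: G3_graph_def graph_union_def triangle_def path_from_2_def undirected_def)
qed

lemma J_graph_eq:
  assumes "3 \<le> n"
  shows "pverts (J_graph n) = {0..<n}"
    "parcs (J_graph n) = triangle_star_arcs n \<union> (triangle_star_arcs n)\<inverse>"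
proof -
  show "pverts (J_graph n) = {0..<n}"
    using assms by (auto simp: J_graph_def graph_union_def triangle_def star_from_2_def undirected_def)
  have "triangle_star_arcs n = {(0, 1), (0, 2), (1, 2)} \<union> {(2, i) | i. 2 < i \<and> i < n}"
    by (auto simp: triangle_star_arcs_def)
  then show "parcs (J_graph n) = triangle_star_arcs n \<union> (triangle_star_arcs n)\<inverse>"
    by (auto simp: J_graph_def graph_union_def triangle_def star_from_2_def undirected_def)
qed

lemma wiener_index_bounds:
  assumes G: "pair_graph G" "unicyclic G" and n: "card (pverts G) = n" "n \<ge> 6"
    and h: "strict_mono_on {1..} h"
  defines "L \<equiv> real n * h 1 + 1 / 2 * real n * (real n - 3) * h 2"
    and "F \<equiv> real n * h 1 + (\<Sum>j = 2..n - 2. (real n - real j) * h j)"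
  shows "L \<le> wiener_index h G" "wiener_index h G \<le> F"
    "wiener_index h G = L \<longleftrightarrow> G \<cong>\<^sub>g J_graph n"
    "wiener_index h G = F \<longleftrightarrow> G \<cong>\<^sub>g G3_graph n"
proof -
  interpret pair_graph G by fact
  have con: "Digraph_Component.connected (with_proj G)" using G(2) by (simp add: unicyclic_def)
  interpret C: connected_graph "pverts G" "parcs G" by (rule connected_graphI[OF con])
  have R: "card (parcs G) = 2 * card (pverts G)" by (rule unicyclic_card_arcs[OF G(2)])
  have n3: "3 \<le> n" "3 \<le> card (pverts G)" using n by auto
  have ne: "pverts G \<noteq> {}" using n3 by auto
  have W: "wiener_index h G = wiener_sum h (pverts G) (parcs G)" by (rule wiener_index_eq_wiener_sum[OF con])
  have F: "F = lollipop_value h (card (pverts G))" by (simp add: F_def n lollipop_value_def)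
  show "L \<le> wiener_index h G"
    using C.wiener_sum_ge_diameter_2(1)[OF h R n3(2)] by (simp add: L_def W n)
  show "wiener_index h G \<le> F"
    unfolding W F using C.wiener_sum_le_lollipop[OF h _ ne] R by simp
  show "wiener_index h G = L \<longleftrightarrow> G \<cong>\<^sub>g J_graph n"
    using C.wiener_sum_eq_diameter_2_iff[OF h R] n
    unfolding graph_iso_iff J_graph_eq[OF n3(1)] W L_def by simp
  show "wiener_index h G = F \<longleftrightarrow> G \<cong>\<^sub>g G3_graph n"
    unfolding graph_iso_iff G3_graph_eq[OF n3(1)] W
  proof
    assume "wiener_sum h (pverts G) (parcs G) = F"
    then show "\<exists>f. bij_betw f (pverts G) {0..<n} \<and>
        map_prod f f ` parcs G = lollipop_arcs n \<union> (lollipop_arcs n)\<inverse>"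
      using C.wiener_sum_eq_lollipop_iso[OF h] R n F by simp
  next
    assume "\<exists>f. bij_betw f (pverts G) {0..<n} \<and>
        map_prod f f ` parcs G = lollipop_arcs n \<union> (lollipop_arcs n)\<inverse>"
    then obtain f where f: "bij_betw f (pverts G) {0..<n}"
      "map_prod f f ` parcs G = lollipop_arcs n \<union> (lollipop_arcs n)\<inverse>" by blast
    \<comment> \<open>The sum is carried over to the labelled graph on \<open>{0..<n}\<close>, where
      it is computed.\<close>
    from wiener_sum_lollipop[OF n3(1), of h] C.connected_graph_image[OF f(1)] C.wiener_sum_image[OF f(1), of h]
    show "wiener_sum h (pverts G) (parcs G) = F" unfolding f(2) F n(1) by simp
  qed
qed

theorem theorem2p7:
  fixes G :: "'a pair_pre_digraph" and n :: nat and h :: "nat \<Rightarrow> real"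
  assumes "pair_graph G" and "unicyclic G" and "card (pverts G) = n" and "n \<ge> 6"
  shows "let L = real n * h 1 + 1 / 2 * real n * (real n - 3) * h 2;
             F = real n * h 1 + (\<Sum>j = 2..n - 2. (real n - real j) * h j)
         in
         (strict_mono_on {1..} h \<longrightarrow>
            L \<le> wiener_index h G \<and> wiener_index h G \<le> F \<and>
            (wiener_index h G = L \<longleftrightarrow> G \<cong>\<^sub>g J_graph n) \<and>
            (wiener_index h G = F \<longleftrightarrow> G \<cong>\<^sub>g G3_graph n)) \<and>
         (strict_antimono_on {1..} h \<longrightarrow>
            F \<le> wiener_index h G \<and> wiener_index h G \<le> L \<and>
            (wiener_index h G = F \<longleftrightarrow> G \<cong>\<^sub>g G3_graph n) \<and>
            (wiener_index h G = L \<longleftrightarrow> G \<cong>\<^sub>g J_graph n))"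
proof -
  define L where "L = real n * h 1 + 1 / 2 * real n * (real n - 3) * h 2"
  define F where "F = real n * h 1 + (\<Sum>j = 2..n - 2. (real n - real j) * h j)"
  let ?g = "\<lambda>j. - h j"
  have neg: "wiener_index ?g G = - wiener_index h G"
    by (simp add: wiener_index_def sum_negf)
  have negL: "real n * ?g 1 + 1 / 2 * real n * (real n - 3) * ?g 2 = - L"
    by (simp add: L_def)
  have negF: "real n * ?g 1 + (\<Sum>j = 2..n - 2. (real n - real j) * ?g j) = - F"
    by (simp add: F_def sum_negf)
  have anti: "strict_mono_on {1..} ?g" if "strict_antimono_on {1..} h"
    using that by (auto simp: monotone_on_def)
  note pos = wiener_index_bounds[OF assms, of h, folded L_def F_def]
  \<comment> \<open>Passing to \<open>-h\<close> negates the index and both bounds, so the two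
    inequalities change roles while the equality cases stay.\<close>
  note neg = wiener_index_bounds[OF assms anti, unfolded neg negL negF neg_le_iff_le neg_equal_iff_equal]
  show ?thesis unfolding Let_def L_def[symmetric] F_def[symmetric]
    using pos neg by blast
qed

end
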